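(* Let $t\geq 4$ and let $G$ be a simple connected $t$-tough graph with $n>10t-3$ vertices and $m$ edges. If at least one of the following holds: (i) $\lambda_{1}(G)\geq\sqrt{n^{2}-(4t+2)n+10t^{2}+2t+1}$; (ii) $q(G)\geq\frac{n^{2}-(4t+1)n+10t^{2}+2t}{n-1}+n-2$; (iii) $\lambda_{1}(D(G))\leq n+4t-1-\frac{10t^{2}+2t}{n}$; (iv) $\eta_{1}(G)\leq 2n+8t-2-\frac{20t^{2}+4t}{n}$, then $G$ is Hamiltonian; moreover, $G$ is pancyclic or bipartite.
   Context: For a graph $H$, $c(H)$ denotes the number of connected components of $H$. For a positive real number $t$, a connected graph $G$ is called $t$-tough if $t\cdot c(G-S)\leq |S|$ for every vertex cut $S\subseteq V(G)$ (i.e., every $S$ with $c(G-S)\geq 2$); complete graphs are $t$-tough for every $t$. A graph on $n$ vertices is Hamiltonian if it has a cycle through all its vertices, and pancyclic if it contains cycles of every length $\ell$ with $3\leq\ell\leq n$. $\lambda_1(G)$ is the largest eigenvalue of the adjacency matrix $A(G)$. $q(G)$ is the largest eigenvalue of the signless Laplacian $Q(G)=D'(G)+A(G)$, where $D'(G)$ is the diagonal matrix of vertex degrees. $D(G)=(d_{ij})$ is the distance matrix, where $d_{ij}$ is the length of a shortest path between $v_i$ and $v_j$, and $\lambda_1(D(G))$ is its largest eigenvalue. The transmission of a vertex $v$ is $Tr(v)=\sum_{u\in V(G)} d(v,u)$; the distance signless Laplacian matrix is $Q_D(G)=\mathrm{Diag}(Tr)+D(G)$, and $\eta_1(G)$ is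 its largest eigenvalue. *)

theory Defs
  imports "HOL-Analysis.Analysis"
begin

text \<open>
  A simple graph whose vertex set is the finite type \<open>'v\<close> is given by its adjacency relation, a
  symmetric irreflexive relation on \<open>'v\<close>; each edge \<open>uv\<close> contributes both \<open>(u, v)\<close> and \<open>(v, u)\<close>.
\<close>

definition simple_graph :: "'v rel \<Rightarrow> bool" where
  "simple_graph G \<longleftrightarrow> sym G \<and> irrefl G"

definition edges :: "'v rel \<Rightarrow> 'v set set" where
  "edges G = {{u, v} | u v. (u, v) \<in> G}"

definition vertex_degree :: "'v rel \<Rightarrow> 'v \<Rightarrow> nat" where
  "vertex_degree G v = card (G `` {v})"

text \<open>
  The connected components of \<open>G - S\<close>, as vertex sets: \<open>G - S\<close> is the graph on \<open>- S\<close> with adjacency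
  relation \<open>Restr G (- S)\<close>, and its components are the classes of reachability on \<open>- S\<close>.
\<close>

definition components_minus :: "'v rel \<Rightarrow> 'v set \<Rightarrow> 'v set set" where
  "components_minus G S = (- S) // (Restr G (- S))\<^sup>*"

definition connected_graph :: "'v rel \<Rightarrow> bool" where
  "connected_graph G \<longleftrightarrow> (\<forall>u v. (u, v) \<in> G\<^sup>*)"

text \<open>A complete graph has no vertex cut, so the condition below is vacuous for it.\<close>

definition tough :: "real \<Rightarrow> 'v::finite rel \<Rightarrow> bool" where
  "tough t G \<longleftrightarrow> connected_graph G \<and>
     (\<forall>S. card (components_minus G S) \<ge> 2 \<longrightarrow> t * real (card (components_minus G S)) \<le> real (card S))"

text \<open>Paths and cycles are lists of their vertices; the closing edge of a cycle is implicit.\<close>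

definition is_path :: "'v rel \<Rightarrow> 'v list \<Rightarrow> bool" where
  "is_path G p \<longleftrightarrow> p \<noteq> [] \<and> distinct p \<and> successively (\<lambda>u v. (u, v) \<in> G) p"

definition is_cycle :: "'v rel \<Rightarrow> 'v list \<Rightarrow> bool" where
  "is_cycle G p \<longleftrightarrow> length p \<ge> 3 \<and> is_path G p \<and> (last p, hd p) \<in> G"

definition hamiltonian :: "'v rel \<Rightarrow> bool" where
  "hamiltonian G \<longleftrightarrow> (\<exists>p. is_cycle G p \<and> set p = UNIV)"

definition pancyclic :: "'v::finite rel \<Rightarrow> bool" where
  "pancyclic G \<longleftrightarrow> (\<forall>l. 3 \<le> l \<and> l \<le> CARD('v) \<longrightarrow> (\<exists>p. is_cycle G p \<and> length p = l))"

definition bipartite :: "'v rel \<Rightarrow> bool" where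
  "bipartite G \<longleftrightarrow> (\<exists>X. \<forall>(u, v) \<in> G. u \<in> X \<longleftrightarrow> v \<notin> X)"

text \<open>The length of a path is its number of edges. The value is meaningful for connected graphs only.\<close>

definition distance :: "'v rel \<Rightarrow> 'v \<Rightarrow> 'v \<Rightarrow> nat" where
  "distance G u v =
     (LEAST k. \<exists>p. is_path G p \<and> hd p = u \<and> last p = v \<and> length p = Suc k)"

definition transmission :: "'v::finite rel \<Rightarrow> 'v \<Rightarrow> nat" where
  "transmission G v = (\<Sum>u\<in>UNIV. distance G v u)"

definition diagonal_matrix :: "('v::finite \<Rightarrow> real) \<Rightarrow> real ^ 'v ^ 'v" where
  "diagonal_matrix d = (\<chi> u v. if u = v then d u else 0)"

definition adjacency_matrix :: "'v::finite rel \<Rightarrow> real ^ 'v ^ 'v" where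
  "adjacency_matrix G = (\<chi> u v. if (u, v) \<in> G then 1 else 0)"

definition signless_laplacian :: "'v::finite rel \<Rightarrow> real ^ 'v ^ 'v" where
  "signless_laplacian G = diagonal_matrix (\<lambda>v. real (vertex_degree G v)) + adjacency_matrix G"

definition distance_matrix :: "'v::finite rel \<Rightarrow> real ^ 'v ^ 'v" where
  "distance_matrix G = (\<chi> u v. real (distance G u v))"

definition distance_signless_laplacian :: "'v::finite rel \<Rightarrow> real ^ 'v ^ 'v" where
  "distance_signless_laplacian G =
     diagonal_matrix (\<lambda>v. real (transmission G v)) + distance_matrix G"

definition eigenvalues :: "real ^ 'v ^ 'v \<Rightarrow> real set" where
  "eigenvalues A = {c. \<exists>x. x \<noteq> 0 \<and> A *v x = c *\<^sub>R x}"

text \<open>Only applied to symmetric matrices, whose spectrum is real, finite and nonempty.\<close>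

definition largest_eigenvalue :: "real ^ 'v ^ 'v \<Rightarrow> real" where
  "largest_eigenvalue A = Max (eigenvalues A)"

end

theory Submission
  imports Defs
begin

text \<open>
  Each spectral condition forces \<open>2m \<ge> n\<^sup>2 - (4t + 1)n + 10t\<^sup>2 + 2t\<close>: condition (i) through Hong's bound
  \<open>\<lambda>\<^sub>1\<^sup>2 \<le> 2m - n + 1\<close>, (ii) through \<open>q \<le> 2m/(n - 1) + n - 2\<close>, and (iii), (iv) through the Rayleigh quotient
  of the all-ones vector, as non-adjacent vertices are at distance at least two.

  Suppose that \<open>G\<close> is not Hamiltonian and add edges until every further edge creates a Hamiltonian
  cycle; this keeps the graph tough. Two non-adjacent vertices are then the ends of a Hamiltonian path,
  and rotations of this path yield a vertex set whose removal leaves many components unless the degree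
  sum of the two ends is well below \<open>n - 1\<close>. For a non-adjacent pair \<open>u, v\<close> of maximum degree sum, the
  non-neighbours of \<open>v\<close> therefore form a large set of vertices of low degree; by toughness it has a small
  independence number, so by Turan's theorem it also spans many edges, which are counted twice in the
  degree sum. This leaves too few edges.

  Finally \<open>2m > n\<^sup>2/2\<close>, so two consecutive vertices of a Hamiltonian cycle have degree sum exceeding
  \<open>n\<close>, and Bondy's pigeonhole argument produces cycles of all lengths.
\<close>

section \<open>Largest eigenvalues\<close>

lemma inner_matrix_symmetric:
  fixes A :: "real ^ 'v::finite ^ 'v"
  assumes "transpose A = A"
  shows "(A *v x) \<bullet> y = x \<bullet> (A *v y)"
  by (metis assms dot_lmul_matrix transpose_matrix_vector)

text \<open>Eigenvectors to distinct eigenvalues are orthogonal, hence linearly independent.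
  Finiteness is what gives the \<open>Max\<close> in \<open>largest_eigenvalue\<close> its
  meaning.\<close>

lemma eigenvalues_finite:
  fixes A :: "real ^ 'v::finite ^ 'v"
  assumes "transpose A = A"
  shows "finite (eigenvalues A)"
proof -
  have "\<forall>c\<in>eigenvalues A. \<exists>x. x \<noteq> 0 \<and> A *v x = c *\<^sub>R x"
    by (auto simp: eigenvalues_def)
  then obtain e where e: "\<And>c. c \<in> eigenvalues A \<Longrightarrow> e c \<noteq> 0 \<and> A *v e c = c *\<^sub>R e c"
    by metis
  have orth: "e c \<bullet> e d = 0" if "c \<in> eigenvalues A" "d \<in> eigenvalues A" "c \<noteq> d" for c d
  proof -
    have "c * (e c \<bullet> e d) = d * (e c \<bullet> e d)"
      using inner_matrix_symmetric[OF assms, of "e c" "e d"] e that by simp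
    then show ?thesis using that by simp
  qed
  have inj: "inj_on e (eigenvalues A)"
    by (rule inj_onI) (metis e inner_eq_zero_iff orth)
  have "pairwise orthogonal (e ` eigenvalues A)"
    using orth by (auto simp: pairwise_def orthogonal_def)
  moreover have "0 \<notin> e ` eigenvalues A" using e by force
  ultimately have "independent (e ` eigenvalues A)"
    by (rule pairwise_orthogonal_independent)
  then show ?thesis
    using inj independent_imp_finite finite_imageD by blast
qed

text \<open>A maximiser \<open>x\<close> of the quadratic form on the unit sphere is an eigenvector:
  otherwise a small move of \<open>x\<close> against the residual \<open>w\<close> would raise the
  Rayleigh quotient above its maximum \<open>c\<close>.\<close>

lemma rayleigh_eigenvalue:
  fixes A :: "real ^ 'v::finite ^ 'v"
  assumes sym: "transpose A = A"
  obtains c where "c \<in> eigenvalues A" "\<And>x. x \<bullet> (A *v x) \<le> c * (x \<bullet> x)"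
proof -
  let ?f = "\<lambda>x. x \<bullet> (A *v x)"
  obtain b :: "real ^ 'v" where "b \<in> Basis" using nonempty_Basis by blast
  then have "sphere (0 :: real ^ 'v) 1 \<noteq> {}" by force
  moreover have "continuous_on (sphere 0 1) ?f"
    by (intro continuous_intros linear_continuous_on matrix_vector_mul_bounded_linear)
  ultimately obtain x where x: "x \<in> sphere 0 1" and max: "\<And>y. y \<in> sphere 0 1 \<Longrightarrow> ?f y \<le> ?f x"
    using continuous_attains_sup[of "sphere (0 :: real ^ 'v) 1" ?f] by auto
  define c where "c = ?f x"
  have xx: "x \<bullet> x = 1" using x by (simp add: dot_square_norm)
  have le: "?f z \<le> c * (z \<bullet> z)" for z
  proof (cases "z = 0")
    case False
    have "?f (z /\<^sub>R norm z) \<le> c"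
      unfolding c_def by (rule max) (use False in simp)
    then have "?f z / (norm z)\<^sup>2 \<le> c"
      by (simp add: matrix_vector_mult_scaleR power2_eq_square field_simps)
    then show ?thesis using False by (simp add: dot_square_norm field_simps)
  qed auto
  define w where "w = c *\<^sub>R x - A *v x"
  define B where "B = c * (w \<bullet> w) - ?f w"
  have B: "B \<ge> 0" using le[of w] by (simp add: B_def)
  \<comment> \<open>Maximality of \<open>c\<close>, tested at \<open>x - s *\<^sub>R w\<close>. The
    left side is linear in \<open>s\<close> and the right side quadratic, so small \<open>s\<close>
    forces \<open>w = 0\<close>.\<close>
  have quad: "2 * s * (w \<bullet> w) \<le> s\<^sup>2 * B" for s
  proof -
    have "?f (x - s *\<^sub>R w) = ?f x - 2 * s * (w \<bullet> (A *v x)) + s\<^sup>2 * ?f w"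
      using inner_matrix_symmetric[OF sym, of x w]
      by (simp add: matrix_vector_mult_diff_distrib matrix_vector_mult_scaleR inner_diff_left
          inner_diff_right power2_eq_square algebra_simps inner_commute)
    moreover have "(x - s *\<^sub>R w) \<bullet> (x - s *\<^sub>R w) = 1 - 2 * s * (w \<bullet> x) + s\<^sup>2 * (w \<bullet> w)"
      using xx by (simp add: inner_diff_left inner_diff_right power2_eq_square algebra_simps inner_commute)
    ultimately have "c - 2 * s * (w \<bullet> (A *v x)) + s\<^sup>2 * ?f w
        \<le> c * (1 - 2 * s * (w \<bullet> x) + s\<^sup>2 * (w \<bullet> w))"
      using le[of "x - s *\<^sub>R w"] by (simp add: c_def)
    moreover have "w \<bullet> w = c * (w \<bullet> x) - w \<bullet> (A *v x)"
      by (simp add: w_def inner_diff_right inner_scaleR_right algebra_simps)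
    then have "2 * s * (w \<bullet> w) = 2 * s * (c * (w \<bullet> x) - w \<bullet> (A *v x))" by simp
    ultimately show ?thesis unfolding B_def by (simp add: algebra_simps)
  qed
  have "w \<bullet> w = 0"
  proof (rule ccontr)
    assume "w \<bullet> w \<noteq> 0"
    then have pos: "w \<bullet> w > 0" by (simp add: order_less_le)
    \<comment> \<open>The denominator \<open>B + 1\<close> is positive even for \<open>B = 0\<close>
      and ensures \<open>s * B \<le> w \<bullet> w\<close>.\<close>
    define s where "s = (w \<bullet> w) / (B + 1)"
    have s: "s > 0" using pos B by (simp add: s_def)
    have "2 * (w \<bullet> w) \<le> s * B"
      using quad[of s] s by (simp add: power2_eq_square)
    also have "s * B \<le> w \<bullet> w"
      using B pos by (simp add: s_def field_simps)
    finally show False using pos by simp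
  qed
  then have "A *v x = c *\<^sub>R x" by (simp add: w_def)
  moreover have "x \<noteq> 0" using xx by auto
  ultimately have "c \<in> eigenvalues A" by (auto simp: eigenvalues_def)
  from this le show ?thesis by (rule that)
qed

lemma largest_eigenvalue_in:
  fixes A :: "real ^ 'v::finite ^ 'v"
  assumes "transpose A = A"
  shows "largest_eigenvalue A \<in> eigenvalues A"
  unfolding largest_eigenvalue_def
  by (rule Max_in) (use eigenvalues_finite rayleigh_eigenvalue assms in \<open>blast+\<close>)

lemma rayleigh_le_largest_eigenvalue:
  fixes A :: "real ^ 'v::finite ^ 'v"
  assumes "transpose A = A"
  shows "x \<bullet> (A *v x) \<le> largest_eigenvalue A * (x \<bullet> x)"
proof -
  obtain c where c: "c \<in> eigenvalues A" "x \<bullet> (A *v x) \<le> c * (x \<bullet> x)"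
    using rayleigh_eigenvalue[OF assms] by metis
  have "c \<le> largest_eigenvalue A"
    unfolding largest_eigenvalue_def using c eigenvalues_finite[OF assms] by simp
  then show ?thesis
    using c(2) mult_right_mono[of c _ "x \<bullet> x"] inner_ge_zero[of x] by fastforce
qed

lemma sum_entries_le_largest_eigenvalue:
  fixes A :: "real ^ 'v::finite ^ 'v"
  assumes "transpose A = A"
  shows "(\<Sum>u\<in>UNIV. \<Sum>v\<in>UNIV. A $ u $ v) \<le> largest_eigenvalue A * real CARD('v)"
  using rayleigh_le_largest_eigenvalue[OF assms, of 1]
  by (simp add: inner_vec_def matrix_vector_mult_def)

section \<open>Degrees\<close>

text \<open>For a simple graph the relation contains each edge twice, so \<open>card G\<close> is
  twice the number of edges; the edge counts below are phrased through it.\<close>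

lemma sum_vertex_degree: "(\<Sum>v\<in>UNIV. vertex_degree G v) = card (G :: 'v::finite rel)"
proof -
  have "G = Sigma UNIV (\<lambda>v. G `` {v})" by auto
  then show ?thesis unfolding vertex_degree_def by (metis card_SigmaI finite)
qed

lemma sum_neighbours:
  fixes G :: "'v::finite rel"
  shows "(\<Sum>u\<in>UNIV. if (v, u) \<in> G then g u else (0::real)) = (\<Sum>u\<in>G `` {v}. g u)"
proof -
  have "{u. (v, u) \<in> G} = G `` {v}" by auto
  then show ?thesis by (simp add: sum.If_cases)
qed

lemma vertex_degree_pos:
  fixes G :: "'v::finite rel"
  assumes "connected_graph G" "CARD('v) \<ge> 2"
  shows "vertex_degree G v \<ge> 1"
proof -
  obtain w where "w \<noteq> v"
    using assms(2) by (metis (full_types) UNIV_eq_I card_1_singleton_iff insertI1 not_less_eq_eq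
        numeral_2_eq_2 singletonI One_nat_def Suc_n_not_le_n)
  moreover have "(v, w) \<in> G\<^sup>*" using assms(1) by (simp add: connected_graph_def)
  ultimately obtain z where "(v, z) \<in> G" by (metis converse_rtranclE)
  then have "G `` {v} \<noteq> {}" by auto
  then show ?thesis by (simp add: vertex_degree_def Suc_le_eq card_gt_0_iff)
qed

text \<open>Connectivity gives every non-neighbour degree at least one. The n - 1 subtracted from
  \<open>card G\<close> in the two spectral bounds below comes from here.\<close>

lemma sum_nonneighbours_degree_ge:
  fixes G :: "'v::finite rel"
  assumes "simple_graph G" "connected_graph G" "CARD('v) \<ge> 2"
  shows "(\<Sum>u\<in>- insert v (G `` {v}). real (vertex_degree G u)) \<ge> real CARD('v) - 1 - real (vertex_degree G v)"
proof -
  have "v \<notin> G `` {v}" using assms(1) by (auto simp: simple_graph_def irrefl_def)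
  then have "card (insert v (G `` {v})) = Suc (vertex_degree G v)"
    by (simp add: vertex_degree_def)
  moreover have "card (insert v (G `` {v})) \<le> CARD('v)" by (rule card_mono) auto
  ultimately have "real (card (- insert v (G `` {v}))) = real CARD('v) - 1 - real (vertex_degree G v)"
    by (simp add: Compl_eq_Diff_UNIV card_Diff_subset of_nat_diff)
  moreover have "(\<Sum>u\<in>- insert v (G `` {v}). real (vertex_degree G u)) \<ge> (\<Sum>u\<in>- insert v (G `` {v}). 1)"
    using vertex_degree_pos[OF assms(2,3)] by (intro sum_mono) simp
  ultimately show ?thesis by simp
qed

lemma sum_split_neighbours:
  fixes G :: "'v::finite rel" and g :: "'v \<Rightarrow> real"
  assumes "simple_graph G"
  shows "sum g UNIV = g v + sum g (G `` {v}) + sum g (- insert v (G `` {v}))"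
proof -
  have "v \<notin> G `` {v}" using assms by (auto simp: simple_graph_def irrefl_def)
  moreover have "sum g UNIV = sum g (insert v (G `` {v})) + sum g (- insert v (G `` {v}))"
    by (metis Compl_eq_Diff_UNIV finite sum.subset_diff top_greatest add.commute)
  ultimately show ?thesis by simp
qed

section \<open>Upper bounds for the adjacency and signless Laplacian eigenvalues\<close>

lemma adjacency_matrix_mult:
  "(adjacency_matrix G *v x) $ v = (\<Sum>u\<in>G `` {v}. x $ u)"
proof -
  have "(adjacency_matrix G *v x) $ v = (\<Sum>u\<in>UNIV. if (v, u) \<in> G then x $ u else 0)"
    unfolding adjacency_matrix_def matrix_vector_mult_def
    by (auto intro!: sum.cong)
  then show ?thesis using sum_neighbours[of v G "\<lambda>u. x $ u"] by simp
qed

lemma diagonal_matrix_mult: "(diagonal_matrix d *v x) $ v = d v * x $ v"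
proof -
  have "(diagonal_matrix d *v x) $ v = (\<Sum>u\<in>UNIV. (if v = u then d v else 0) * x $ u)"
    by (simp add: diagonal_matrix_def matrix_vector_mult_def)
  also have "\<dots> = (\<Sum>u\<in>UNIV. if v = u then d v * x $ u else 0)"
    by (rule sum.cong) auto
  finally show ?thesis by simp
qed

lemma transpose_adjacency_matrix: "simple_graph G \<Longrightarrow> transpose (adjacency_matrix G) = adjacency_matrix G"
  by (auto simp: transpose_def adjacency_matrix_def simple_graph_def sym_def vec_eq_iff)

lemma transpose_signless_laplacian: "simple_graph G \<Longrightarrow> transpose (signless_laplacian G) = signless_laplacian G"
  by (auto simp: transpose_def signless_laplacian_def diagonal_matrix_def adjacency_matrix_def
      simple_graph_def sym_def vec_eq_iff)

text \<open>Being distinct and non-adjacent is a symmetric relation, so a double sum over such pairs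
  can be read from either end.\<close>

lemma sum_nonneighbours_swap:
  fixes G :: "'v::finite rel" and a b :: "'v \<Rightarrow> real"
  assumes "simple_graph G"
  shows "(\<Sum>v\<in>UNIV. a v * (\<Sum>u\<in>- insert v (G `` {v}). b u))
    = (\<Sum>u\<in>UNIV. b u * (\<Sum>v\<in>- insert u (G `` {u}). a v))"
proof -
  have s: "(u, v) \<in> G \<longleftrightarrow> (v, u) \<in> G" for u v
    using assms by (auto simp: simple_graph_def sym_def)
  have *: "(\<Sum>u\<in>- insert v (G `` {v}). c u) = (\<Sum>u\<in>UNIV. if u \<noteq> v \<and> (v, u) \<notin> G then c u else 0)"
    for v and c :: "'v \<Rightarrow> real"
  proof -
    have "- insert v (G `` {v}) = {u. u \<noteq> v \<and> (v, u) \<notin> G}" by auto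
    then show ?thesis by (simp add: sum.If_cases)
  qed
  show ?thesis
    unfolding * sum_distrib_left
    by (subst sum.swap) (auto intro!: sum.cong simp: s)
qed

text \<open>Cauchy-Schwarz in the eigenvalue equation at \<open>v\<close> bounds the square of
  \<open>l * x $ v\<close> by d(v) times the sum of squares over the neighbours, which is
  \<open>X\<close> minus the squares elsewhere. After summing over \<open>v\<close> and swapping,
  the non-neighbour degrees contribute at least n - 1 - d(v), and the terms with d(v)
  cancel.\<close>

theorem hong_bound:
  fixes G :: "'v::finite rel"
  assumes G: "simple_graph G" "connected_graph G" "CARD('v) \<ge> 2"
  shows "(largest_eigenvalue (adjacency_matrix G))\<^sup>2 \<le> real (card G) - real CARD('v) + 1"
proof -
  let ?d = "\<lambda>v. real (vertex_degree G v)"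
  let ?N = "\<lambda>v. - insert v (G `` {v})"
  define l where "l = largest_eigenvalue (adjacency_matrix G)"
  obtain x where x: "x \<noteq> 0" "adjacency_matrix G *v x = l *\<^sub>R x"
    using largest_eigenvalue_in[OF transpose_adjacency_matrix[OF G(1)]]
    by (auto simp: eigenvalues_def l_def)
  define X where "X = (\<Sum>v\<in>UNIV. (x $ v)\<^sup>2)"
  obtain w where "x $ w \<noteq> 0" using x(1) by (auto simp: vec_eq_iff)
  then have X: "X > 0" unfolding X_def by (intro sum_pos2[where i = w]) auto
  have "(l * x $ v)\<^sup>2 \<le> ?d v * (X - (x $ v)\<^sup>2 - (\<Sum>u\<in>?N v. (x $ u)\<^sup>2))" for v
  proof -
    have "l * x $ v = (\<Sum>u\<in>G `` {v}. x $ u)"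
      using x(2) adjacency_matrix_mult[of G x v] by simp
    also have "\<dots>\<^sup>2 \<le> ?d v * (\<Sum>u\<in>G `` {v}. (x $ u)\<^sup>2)"
      using Cauchy_Schwarz_ineq_sum[of "\<lambda>_. 1" "\<lambda>u. x $ u" "G `` {v}"]
      by (simp add: vertex_degree_def)
    also have "(\<Sum>u\<in>G `` {v}. (x $ u)\<^sup>2) = X - (x $ v)\<^sup>2 - (\<Sum>u\<in>?N v. (x $ u)\<^sup>2)"
      using sum_split_neighbours[OF G(1), of "\<lambda>u. (x $ u)\<^sup>2" v] by (simp add: X_def)
    finally show ?thesis .
  qed
  then have "(\<Sum>v\<in>UNIV. (l * x $ v)\<^sup>2) \<le> (\<Sum>v\<in>UNIV. ?d v * (X - (x $ v)\<^sup>2 - (\<Sum>u\<in>?N v. (x $ u)\<^sup>2)))"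
    by (rule sum_mono)
  also have "\<dots> = (\<Sum>v\<in>UNIV. ?d v) * X - (\<Sum>v\<in>UNIV. (x $ v)\<^sup>2 * ?d v)
      - (\<Sum>v\<in>UNIV. ?d v * (\<Sum>u\<in>?N v. (x $ u)\<^sup>2))"
    unfolding sum_distrib_right sum_subtractf[symmetric]
    by (rule sum.cong) (auto simp: algebra_simps)
  also have "(\<Sum>v\<in>UNIV. ?d v * (\<Sum>u\<in>?N v. (x $ u)\<^sup>2)) = (\<Sum>v\<in>UNIV. (x $ v)\<^sup>2 * (\<Sum>u\<in>?N v. ?d u))"
    by (rule sum_nonneighbours_swap[OF G(1)])
  finally have "(\<Sum>v\<in>UNIV. (l * x $ v)\<^sup>2) \<le> (\<Sum>v\<in>UNIV. ?d v) * X - (\<Sum>v\<in>UNIV. (x $ v)\<^sup>2 * ?d v)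
      - (\<Sum>v\<in>UNIV. (x $ v)\<^sup>2 * (\<Sum>u\<in>?N v. ?d u))" .
  moreover have "(\<Sum>v\<in>UNIV. (x $ v)\<^sup>2 * (real CARD('v) - 1 - ?d v)) \<le> (\<Sum>v\<in>UNIV. (x $ v)\<^sup>2 * (\<Sum>u\<in>?N v. ?d u))"
    using sum_nonneighbours_degree_ge[OF G] by (intro sum_mono mult_left_mono) auto
  moreover have "(\<Sum>v\<in>UNIV. (x $ v)\<^sup>2 * (real CARD('v) - 1 - ?d v))
      = (real CARD('v) - 1) * X - (\<Sum>v\<in>UNIV. (x $ v)\<^sup>2 * ?d v)"
    unfolding X_def sum_distrib_left sum_subtractf[symmetric]
    by (rule sum.cong) (auto simp: algebra_simps)
  moreover have "(\<Sum>v\<in>UNIV. ?d v) = real (card G)"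
    unfolding sum_vertex_degree[symmetric] by simp
  moreover have "(\<Sum>v\<in>UNIV. (l * x $ v)\<^sup>2) = l\<^sup>2 * X"
    by (simp add: X_def power_mult_distrib sum_distrib_left)
  ultimately have "l\<^sup>2 * X \<le> (real (card G) - real CARD('v) + 1) * X"
    by (simp add: algebra_simps)
  then show ?thesis using X by (simp add: l_def)
qed

text \<open>For positive \<open>M\<close> the convex function d + M/d takes equal values at
  \<open>k\<close> and at \<open>M / k\<close>, and the assumptions place \<open>d\<close> between
  these points.\<close>

lemma convex_endpoint_bound:
  fixes d M k :: real
  assumes "0 < d" "d \<le> k" "M \<le> d * k"
  shows "d + M / d \<le> k + M / k"
proof -
  have "0 \<le> (k - d) * (d * k - M)" using assms by simp
  then have "d * d * k + M * k \<le> k * k * d + M * d" by (simp add: algebra_simps)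
  then show ?thesis using assms by (simp add: field_simps)
qed

text \<open>At a vertex \<open>v\<close> maximising |x_v| / d(v), the eigenvalue equation gives q
  \<le> d(v) + T / d(v), where \<open>T\<close> is the degree sum of the neighbours of
  \<open>v\<close>. Two bounds on \<open>T\<close> are available: \<open>M\<close>, because the
  non-neighbours have positive degree, and d(v) times n - 1.\<close>

theorem signless_laplacian_bound:
  fixes G :: "'v::finite rel"
  assumes G: "simple_graph G" "connected_graph G" "CARD('v) \<ge> 2"
  shows "largest_eigenvalue (signless_laplacian G)
    \<le> real (card G) / (real CARD('v) - 1) + real CARD('v) - 2"
proof -
  let ?d = "\<lambda>v. real (vertex_degree G v)"
  let ?k = "real CARD('v) - 1"
  define M where "M = real (card G) - ?k"
  define q where "q = largest_eigenvalue (signless_laplacian G)"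
  have dpos: "?d v \<ge> 1" for v using vertex_degree_pos[OF G(2,3)] by simp
  have dle: "?d v \<le> ?k" for v
  proof -
    have "G `` {v} \<subseteq> UNIV - {v}" using G(1) by (auto simp: simple_graph_def irrefl_def)
    then have "vertex_degree G v \<le> card (UNIV - {v})"
      unfolding vertex_degree_def by (intro card_mono) auto
    then show ?thesis using G(3) by (simp add: card_Diff_singleton of_nat_diff)
  qed
  have kpos: "?k > 0" using G(3) by simp
  obtain x where x: "x \<noteq> 0" "signless_laplacian G *v x = q *\<^sub>R x"
    using largest_eigenvalue_in[OF transpose_signless_laplacian[OF G(1)]]
    by (auto simp: eigenvalues_def q_def)
  have eq: "q * x $ v = ?d v * x $ v + (\<Sum>u\<in>G `` {v}. x $ u)" for v
    using x(2) adjacency_matrix_mult[of G x v] diagonal_matrix_mult[of ?d x v]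
    by (metis matrix_vector_mult_add_rdistrib signless_laplacian_def vector_add_component
        vector_scaleR_component real_scaleR_def)
  define y where "y = (\<lambda>v. \<bar>x $ v\<bar> / ?d v)"
  obtain v where v: "\<And>u. y u \<le> y v"
  proof -
    have "Max (range y) \<in> range y" by (rule Max_in) auto
    then obtain v where "y v = Max (range y)" by (metis imageE)
    then have "y u \<le> y v" for u by simp
    then show ?thesis using that by blast
  qed
  have xy: "\<bar>x $ u\<bar> = ?d u * y u" for u using dpos[of u] by (simp add: y_def)
  have ypos: "y v > 0"
  proof -
    obtain w where "x $ w \<noteq> 0" using x(1) by (auto simp: vec_eq_iff)
    then have "y w > 0" using dpos[of w] by (simp add: y_def)
    then show ?thesis using v[of w] by simp
  qed
  define T where "T = (\<Sum>u\<in>G `` {v}. ?d u)"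
  have "(q - ?d v) * \<bar>x $ v\<bar> \<le> \<bar>(q - ?d v) * x $ v\<bar>" by (simp add: abs_mult mult_right_mono)
  also have "(q - ?d v) * x $ v = (\<Sum>u\<in>G `` {v}. x $ u)" using eq[of v] by (simp add: algebra_simps)
  also have "\<bar>\<dots>\<bar> \<le> (\<Sum>u\<in>G `` {v}. \<bar>x $ u\<bar>)" by (rule sum_abs)
  also have "\<dots> \<le> (\<Sum>u\<in>G `` {v}. ?d u * y v)"
    unfolding xy by (intro sum_mono mult_left_mono v) auto
  also have "\<dots> = T * y v" by (simp add: T_def sum_distrib_right)
  finally have "((q - ?d v) * ?d v) * y v \<le> T * y v" by (simp add: xy algebra_simps)
  then have qT: "(q - ?d v) * ?d v \<le> T" using ypos by simp
  have "T \<le> M"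
  proof -
    have "(\<Sum>u\<in>UNIV. ?d u) = real (card G)" unfolding sum_vertex_degree[symmetric] by simp
    then show ?thesis
      using sum_split_neighbours[OF G(1), of ?d v] sum_nonneighbours_degree_ge[OF G, of v]
      unfolding T_def M_def by linarith
  qed
  have "T \<le> ?d v * ?k"
  proof -
    have "T \<le> (\<Sum>u\<in>G `` {v}. ?k)" unfolding T_def by (intro sum_mono dle)
    then show ?thesis by (simp add: vertex_degree_def)
  qed
  \<comment> \<open>The smaller of the two bounds on \<open>T\<close> is used. If it is
    \<open>M\<close>, convexity applies; otherwise q \<le> d(v) + \<open>?k\<close>, and d(v) is at
    most \<open>M / ?k\<close>.\<close>
  have "q \<le> ?k + M / ?k"
  proof (cases "M \<le> ?d v * ?k")
    case True
    have "(q - ?d v) * ?d v \<le> M" using qT \<open>T \<le> M\<close> by simp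
    then have "q - ?d v \<le> M / ?d v" using dpos[of v] by (simp add: field_simps)
    then have "q \<le> ?d v + M / ?d v" by simp
    also have "\<dots> \<le> ?k + M / ?k"
      using True dpos[of v] dle[of v] by (intro convex_endpoint_bound) auto
    finally show ?thesis .
  next
    case False
    then have "?d v \<le> M / ?k" using kpos by (simp add: field_simps)
    moreover have "(q - ?d v) * ?d v \<le> ?k * ?d v" using qT \<open>T \<le> ?d v * ?k\<close> by (simp add: mult.commute)
    then have "q - ?d v \<le> ?k" using dpos[of v] by simp
    ultimately show ?thesis by simp
  qed
  also have "?k + M / ?k = real (card G) / ?k + real CARD('v) - 2"
    using kpos by (simp add: M_def diff_divide_distrib)
  finally show ?thesis by (simp add: q_def)
qed

section \<open>Distances and lower bounds for the distance eigenvalues\<close>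

lemma rtrancl_imp_path:
  assumes "(u, v) \<in> G\<^sup>*"
  shows "\<exists>p. is_path G p \<and> hd p = u \<and> last p = v"
  using assms
proof (induction rule: rtrancl_induct)
  case base
  have "is_path G [u]" by (simp add: is_path_def)
  then show ?case by force
next
  case (step y z)
  then obtain p where p: "is_path G p" "hd p = u" "last p = y" by blast
  show ?case
  proof (cases "z \<in> set p")
    case False
    then have "is_path G (p @ [z])"
      using p step by (auto simp: is_path_def successively_append_iff)
    then show ?thesis using p by (intro exI[of _ "p @ [z]"]) (auto simp: is_path_def)
  next
    \<comment> \<open>The new vertex already lies on the path, which is cut there to keep its
      vertices distinct.\<close>
    case True
    then obtain as bs where "p = as @ z # bs" by (meson split_list)
    then have "is_path G (as @ [z])" "hd (as @ [z]) = u"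
      using p by (auto simp: is_path_def successively_append_iff hd_append)
    then show ?thesis by (intro exI[of _ "as @ [z]"]) auto
  qed
qed

text \<open>Connectivity makes the set under the \<open>LEAST\<close> in \<open>distance\<close>
  nonempty, so the minimum is attained.\<close>

lemma distance_witness:
  assumes "connected_graph G"
  shows "\<exists>p. is_path G p \<and> hd p = u \<and> last p = v \<and> length p = Suc (distance G u v)"
proof -
  obtain p where p: "is_path G p" "hd p = u" "last p = v"
    using rtrancl_imp_path[of u v G] assms by (auto simp: connected_graph_def)
  then have "\<exists>q. is_path G q \<and> hd q = u \<and> last q = v \<and> length q = Suc (length p - 1)"
    by (intro exI[of _ p]) (auto simp: is_path_def)
  then show ?thesis unfolding distance_def by (rule LeastI)
qed

lemma distance_ge_1:
  assumes "connected_graph G" "u \<noteq> v"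
  shows "distance G u v \<ge> 1"
proof (rule ccontr)
  obtain p where p: "is_path G p" "hd p = u" "last p = v" "length p = Suc (distance G u v)"
    using distance_witness[OF assms(1)] by blast
  assume "\<not> distance G u v \<ge> 1"
  then have "length p = 1" using p by simp
  then show False using p assms(2) by (auto simp: length_Suc_conv)
qed

lemma distance_ge_2:
  assumes "connected_graph G" "u \<noteq> v" "(u, v) \<notin> G"
  shows "distance G u v \<ge> 2"
proof (rule ccontr)
  obtain p where p: "is_path G p" "hd p = u" "last p = v" "length p = Suc (distance G u v)"
    using distance_witness[OF assms(1)] by blast
  assume "\<not> distance G u v \<ge> 2"
  then have "length p = 2" using p distance_ge_1[OF assms(1,2)] by simp
  then obtain a b where "p = [a, b]" by (auto simp: numeral_2_eq_2 length_Suc_conv)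
  then show False using p assms(3) by (auto simp: is_path_def)
qed

lemma distance_le_reverse:
  assumes "simple_graph G" "connected_graph G"
  shows "distance G u v \<le> distance G v u"
proof -
  obtain p where p: "is_path G p" "hd p = v" "last p = u" "length p = Suc (distance G v u)"
    using distance_witness[OF assms(2)] by blast
  have "successively (\<lambda>x y. (y, x) \<in> G) p"
    using p(1) assms(1) by (auto simp: is_path_def simple_graph_def elim!: successively_mono dest: symD)
  then have "is_path G (rev p)" "hd (rev p) = u" "last (rev p) = v"
    using p by (auto simp: is_path_def hd_rev last_rev)
  then show ?thesis unfolding distance_def[of G u v]
    by (intro Least_le exI[of _ "rev p"]) (use p in auto)
qed

lemma distance_commute:
  "simple_graph G \<Longrightarrow> connected_graph G \<Longrightarrow> distance G u v = distance G v u"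
  by (simp add: distance_le_reverse le_antisym)

lemma sum_distance_ge:
  fixes G :: "'v::finite rel"
  assumes "connected_graph G"
  shows "(\<Sum>u\<in>UNIV. \<Sum>v\<in>UNIV. real (distance G u v))
    \<ge> 2 * real CARD('v) * (real CARD('v) - 1) - real (card G)"
proof -
  \<comment> \<open>The right side is at most 0 on the diagonal; off it, it is 1 on adjacent and 2
    on non-adjacent pairs.\<close>
  have "real (distance G u v) \<ge> 2 - (if v = u then 2 else 0) - (if (u, v) \<in> G then 1 else 0)" for u v
    using distance_ge_1[OF assms, of u v] distance_ge_2[OF assms, of u v] by auto
  then have "(\<Sum>u\<in>UNIV. \<Sum>v\<in>UNIV. real (distance G u v))
     \<ge> (\<Sum>u\<in>UNIV. \<Sum>v\<in>UNIV. 2 - (if v = u then 2 else 0) - (if (u, v) \<in> G then 1 else 0))"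
    by (intro sum_mono)
  also have "(\<Sum>u\<in>UNIV. \<Sum>v\<in>UNIV. 2 - (if v = u then 2 else 0) - (if (u, v) \<in> G then 1 else 0))
    = (\<Sum>u::'v\<in>UNIV. 2 * real CARD('v) - 2 - real (vertex_degree G u))"
    using sum_neighbours[of _ G "\<lambda>_. 1"]
    by (simp add: sum_subtractf vertex_degree_def)
  also have "\<dots> = 2 * real CARD('v) * (real CARD('v) - 1) - real (card G)"
    unfolding sum_vertex_degree[symmetric]
    by (simp add: sum_subtractf sum.distrib algebra_simps)
  finally show ?thesis .
qed

lemma transpose_distance_matrix:
  "simple_graph G \<Longrightarrow> connected_graph G \<Longrightarrow> transpose (distance_matrix G) = distance_matrix G"
  by (simp add: transpose_def distance_matrix_def vec_eq_iff distance_commute)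

lemma transpose_distance_signless_laplacian:
  "simple_graph G \<Longrightarrow> connected_graph G \<Longrightarrow>
     transpose (distance_signless_laplacian G) = distance_signless_laplacian G"
  by (auto simp: transpose_def distance_signless_laplacian_def diagonal_matrix_def
      distance_matrix_def vec_eq_iff distance_commute)

lemma distance_matrix_bound:
  fixes G :: "'v::finite rel"
  assumes "simple_graph G" "connected_graph G"
  shows "largest_eigenvalue (distance_matrix G)
    \<ge> 2 * (real CARD('v) - 1) - real (card G) / real CARD('v)"
  using sum_entries_le_largest_eigenvalue[OF transpose_distance_matrix[OF assms]]
    sum_distance_ge[OF assms(2)]
  by (simp add: distance_matrix_def field_simps)

text \<open>The diagonal repeats each row sum of the distance matrix, so the all-ones vector yields
  twice the bound for \<open>distance_matrix\<close>.\<close>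

lemma distance_signless_laplacian_bound:
  fixes G :: "'v::finite rel"
  assumes "simple_graph G" "connected_graph G"
  shows "largest_eigenvalue (distance_signless_laplacian G)
    \<ge> 4 * (real CARD('v) - 1) - 2 * real (card G) / real CARD('v)"
proof -
  have "(\<Sum>v\<in>UNIV. distance_signless_laplacian G $ u $ v) = 2 * (\<Sum>v\<in>UNIV. real (distance G u v))" for u
    by (simp add: distance_signless_laplacian_def diagonal_matrix_def distance_matrix_def
        sum.distrib transmission_def)
  then have "(\<Sum>u\<in>UNIV. \<Sum>v\<in>UNIV. distance_signless_laplacian G $ u $ v)
     = 2 * (\<Sum>u\<in>UNIV. \<Sum>v\<in>UNIV. real (distance G u v))"
    by (simp add: sum_distrib_left)
  then show ?thesis
    using sum_entries_le_largest_eigenvalue[OF transpose_distance_signless_laplacian[OF assms]]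
      sum_distance_ge[OF assms(2)]
    by (simp add: field_simps)
qed

section \<open>From the spectral conditions to the number of edges\<close>

lemma spectral_condition_card:
  fixes G :: "'v::finite rel" and t :: real
  assumes G: "simple_graph G" "connected_graph G" and n: "n = CARD('v)" "n \<ge> 2"
    and spec: "largest_eigenvalue (adjacency_matrix G)
           \<ge> sqrt ((real n)\<^sup>2 - (4 * t + 2) * real n + 10 * t\<^sup>2 + 2 * t + 1)
       \<or> largest_eigenvalue (signless_laplacian G)
           \<ge> ((real n)\<^sup>2 - (4 * t + 1) * real n + 10 * t\<^sup>2 + 2 * t) / (real n - 1) + real n - 2
       \<or> largest_eigenvalue (distance_matrix G)
           \<le> real n + 4 * t - 1 - (10 * t\<^sup>2 + 2 * t) / real n
       \<or> largest_eigenvalue (distance_signless_laplacian G)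
           \<le> 2 * real n + 8 * t - 2 - (20 * t\<^sup>2 + 4 * t) / real n"
  shows "real (card G) \<ge> (real n)\<^sup>2 - (4 * t + 1) * real n + 10 * t\<^sup>2 + 2 * t" (is "_ \<ge> ?N")
  using spec
proof (elim disjE)
  assume "largest_eigenvalue (adjacency_matrix G)
           \<ge> sqrt ((real n)\<^sup>2 - (4 * t + 2) * real n + 10 * t\<^sup>2 + 2 * t + 1)"
  then have "(real n)\<^sup>2 - (4 * t + 2) * real n + 10 * t\<^sup>2 + 2 * t + 1
      \<le> (largest_eigenvalue (adjacency_matrix G))\<^sup>2"
    by (rule sqrt_le_D)
  then show ?thesis using hong_bound[OF G] n by (simp add: algebra_simps)
next
  assume "largest_eigenvalue (signless_laplacian G)
           \<ge> ((real n)\<^sup>2 - (4 * t + 1) * real n + 10 * t\<^sup>2 + 2 * t) / (real n - 1) + real n - 2"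
  then have "((real n)\<^sup>2 - (4 * t + 1) * real n + 10 * t\<^sup>2 + 2 * t) / (real n - 1)
      \<le> real (card G) / (real n - 1)"
    using signless_laplacian_bound[OF G] n by simp
  then show ?thesis using n(2) by (simp add: divide_le_cancel)
next
  assume "largest_eigenvalue (distance_matrix G)
           \<le> real n + 4 * t - 1 - (10 * t\<^sup>2 + 2 * t) / real n"
  then have "2 * (real n - 1) - real (card G) / real n
      \<le> real n + 4 * t - 1 - (10 * t\<^sup>2 + 2 * t) / real n"
    using distance_matrix_bound[OF G] n by simp
  moreover have "?N / real n = real n - (4 * t + 1) + (10 * t\<^sup>2 + 2 * t) / real n"
    using n(2) by (simp add: field_simps power2_eq_square)
  ultimately have "?N / real n \<le> real (card G) / real n" by simp
  then show ?thesis using n(2) by (simp add: divide_le_cancel)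
next
  assume "largest_eigenvalue (distance_signless_laplacian G)
           \<le> 2 * real n + 8 * t - 2 - (20 * t\<^sup>2 + 4 * t) / real n"
  moreover define c r where "c = real (card G) / real n" and "r = (10 * t\<^sup>2 + 2 * t) / real n"
  moreover have "2 * real (card G) / real n = 2 * c" "(20 * t\<^sup>2 + 4 * t) / real n = 2 * r"
    using n(2) by (simp_all add: c_def r_def field_simps)
  ultimately have "4 * (real n - 1) - 2 * c \<le> 2 * real n + 8 * t - 2 - 2 * r"
    using distance_signless_laplacian_bound[OF G] n by simp
  \<comment> \<open>Halved, the inequality is the one of the distance matrix case.\<close>
  then have "real n - (4 * t + 1) + r \<le> c" by simp
  moreover have "?N / real n = real n - (4 * t + 1) + r"
    using n(2) by (simp add: r_def field_simps power2_eq_square)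
  ultimately have "?N / real n \<le> c" by metis
  then show ?thesis using n(2) by (simp add: c_def divide_le_cancel)
qed

section \<open>Toughness\<close>

text \<open>A labelling that is constant along the edges of \<open>G - S\<close> is constant on
  components, so there are at most as many labels as components. Toughness can then be applied by
  exhibiting labels only.\<close>

lemma tough_labelling:
  fixes G :: "'v::finite rel"
  assumes "tough t G" "t \<ge> 0" "sym G"
    and lab: "\<And>u v. u \<notin> S \<Longrightarrow> v \<notin> S \<Longrightarrow> (u, v) \<in> G \<Longrightarrow> f u = f v"
    and two: "card (f ` (- S)) \<ge> 2"
  shows "t * real (card (f ` (- S))) \<le> real (card S)"
proof -
  let ?R = "(Restr G (- S))\<^sup>*"
  have const: "f u = f v" if "(u, v) \<in> ?R" for u v
    using that by (induction rule: rtrancl_induct) (auto dest: lab)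
  have "f ` (- S) = (\<lambda>C. f (SOME v. v \<in> C)) ` components_minus G S"
  proof -
    have "f (SOME v. v \<in> ?R `` {u}) = f u" for u
    proof -
      have "(SOME v. v \<in> ?R `` {u}) \<in> ?R `` {u}" by (rule someI[of _ u]) simp
      then show ?thesis using const by auto
    qed
    then show ?thesis by (auto simp: components_minus_def quotient_def image_iff)
  qed
  then have le: "card (f ` (- S)) \<le> card (components_minus G S)"
    by (simp add: card_image_le)
  then have "t * real (card (f ` (- S))) \<le> t * real (card (components_minus G S))"
    using assms(2) by (intro mult_left_mono) auto
  also have "\<dots> \<le> real (card S)"
    using assms(1) le two by (auto simp: tough_def)
  finally show ?thesis .
qed

text \<open>The components of \<open>H - S\<close> serve as labels for \<open>G\<close>, whose edges
  cannot leave them. This carries toughness over to an edge-maximal supergraph.\<close>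

lemma tough_mono:
  fixes G H :: "'v::finite rel"
  assumes "tough t G" "t \<ge> 0" "sym G" "sym H" "G \<subseteq> H"
  shows "tough t H"
  unfolding tough_def
proof (intro conjI allI impI)
  show "connected_graph H"
    using assms(1,5) rtrancl_mono[of G H] by (auto simp: tough_def connected_graph_def)
  fix S :: "'v set"
  let ?R = "(Restr H (- S))\<^sup>*"
  let ?f = "\<lambda>v. ?R `` {v}"
  have img: "?f ` (- S) = components_minus H S"
    by (auto simp: components_minus_def quotient_def)
  assume two: "card (components_minus H S) \<ge> 2"
  have "sym (Restr H (- S))" using assms(4) by (auto simp: sym_def)
  then have "sym ?R" by (rule sym_rtrancl)
  have "?f u = ?f v" if "u \<notin> S" "v \<notin> S" "(u, v) \<in> G" for u v
  proof -
    have "(u, v) \<in> ?R" using that assms(5) by auto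
    moreover have "(v, u) \<in> ?R" using \<open>sym ?R\<close> calculation by (auto dest: symD)
    ultimately show ?thesis by (auto intro: rtrancl_trans)
  qed
  then have "t * real (card (?f ` (- S))) \<le> real (card S)"
    using tough_labelling[OF assms(1-3), of S ?f] two img by simp
  then show "t * real (card (components_minus H S)) \<le> real (card S)" using img by simp
qed

definition independent_set :: "'v rel \<Rightarrow> 'v set \<Rightarrow> bool" where
  "independent_set G A \<longleftrightarrow> (\<forall>u\<in>A. \<forall>v\<in>A. (u, v) \<notin> G)"

text \<open>Removing all vertices outside \<open>A\<close> leaves the vertices of \<open>A\<close>
  isolated.\<close>

lemma tough_independent_card:
  fixes G :: "'v::finite rel"
  assumes "tough t G" "t \<ge> 0" "sym G" "independent_set G A" "card A \<ge> 2"
  shows "(t + 1) * real (card A) \<le> real CARD('v)"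
proof -
  have "t * real (card ((\<lambda>v. v) ` (- (- A)))) \<le> real (card (- A))"
    by (rule tough_labelling) (use assms in \<open>auto simp: independent_set_def\<close>)
  moreover have "real (card (- A)) = real CARD('v) - real (card A)"
    by (simp add: Compl_eq_Diff_UNIV card_Diff_subset card_mono of_nat_diff)
  ultimately show ?thesis by (simp add: algebra_simps)
qed

text \<open>Removing the neighbourhood of \<open>u\<close> separates \<open>u\<close> from
  \<open>v\<close>.\<close>

lemma tough_degree:
  fixes G :: "'v::finite rel"
  assumes "tough t G" "t \<ge> 0" "simple_graph G" "u \<noteq> v" "(u, v) \<notin> G"
  shows "2 * t \<le> real (vertex_degree G u)"
proof -
  have sy: "sym G" and ir: "(u, u) \<notin> G"
    using assms(3) by (auto simp: simple_graph_def irrefl_def)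
  let ?f = "\<lambda>w. if w = u then u else v"
  have "?f ` (- (G `` {u})) = {u, v}" using assms(4,5) ir by auto
  moreover have "card {u, v} = 2" using assms(4) by simp
  moreover have "t * real (card (?f ` (- (G `` {u})))) \<le> real (card (G `` {u}))"
    by (rule tough_labelling[OF assms(1,2) sy]) (use sy calculation in \<open>auto dest: symD\<close>)
  ultimately show ?thesis by (simp add: vertex_degree_def)
qed

section \<open>Turan's bound\<close>

text \<open>Greedy choice: take a vertex \<open>w\<close> of least degree in the graph induced on
  \<open>I\<close> and delete its closed neighbourhood \<open>K\<close>. The deleted terms number
  d(w) + 1 and each is at most 1 / (d(w) + 1), so they sum to at most 1; the other terms only grow
  when degrees drop.\<close>

lemma caro_wei:
  fixes G :: "'v::finite rel"
  assumes G: "simple_graph G"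
  shows "\<exists>A\<subseteq>I. independent_set G A \<and> (\<Sum>v\<in>I. 1 / (real (card (G `` {v} \<inter> I)) + 1)) \<le> real (card A)"
proof (induction "card I" arbitrary: I rule: less_induct)
  case less
  let ?d = "\<lambda>I v. real (card (G `` {v} \<inter> I)) + 1"
  show ?case
  proof (cases "I = {}")
    case False
    define w where "w = arg_min_on (\<lambda>v. card (G `` {v} \<inter> I)) I"
    have w: "w \<in> I" unfolding w_def by (rule arg_min_if_finite(1)) (use False in auto)
    have w_min: "card (G `` {w} \<inter> I) \<le> card (G `` {v} \<inter> I)" if "v \<in> I" for v
      unfolding w_def by (rule arg_min_least) (use False that in auto)
    have irr: "w \<notin> G `` {w}" using G by (auto simp: simple_graph_def irrefl_def)
    define K where "K = insert w (G `` {w} \<inter> I)"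
    define J where "J = I - K"
    have KI: "K \<subseteq> I" using w by (auto simp: K_def)
    have "J \<subset> I" using w by (auto simp: J_def K_def)
    then have "card J < card I" by (intro psubset_card_mono) auto
    then obtain A where A: "A \<subseteq> J" "independent_set G A" "(\<Sum>v\<in>J. 1 / ?d J v) \<le> real (card A)"
      using less by blast
    have "independent_set G (insert w A)"
      using A G by (auto simp: independent_set_def J_def K_def simple_graph_def irrefl_def dest: symD)
    moreover have "w \<notin> A" using A(1) by (auto simp: J_def K_def)
    moreover have "(\<Sum>v\<in>K. 1 / ?d I v) \<le> 1"
    proof -
      have "(\<Sum>v\<in>K. 1 / ?d I v) \<le> (\<Sum>v\<in>K. 1 / ?d I w)"
        using w_min KI by (intro sum_mono divide_left_mono) auto
      also have "\<dots> = 1" using irr by (simp add: K_def)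
      finally show ?thesis .
    qed
    moreover have "(\<Sum>v\<in>J. 1 / ?d I v) \<le> (\<Sum>v\<in>J. 1 / ?d J v)"
    proof (intro sum_mono divide_left_mono)
      show "?d J v \<le> ?d I v" for v
        using \<open>J \<subset> I\<close> by (auto intro!: card_mono)
    qed auto
    moreover have "(\<Sum>v\<in>I. 1 / ?d I v) = (\<Sum>v\<in>J. 1 / ?d I v) + (\<Sum>v\<in>K. 1 / ?d I v)"
      unfolding J_def using KI by (intro sum.subset_diff) auto
    ultimately have "(\<Sum>v\<in>I. 1 / ?d I v) \<le> real (card (insert w A))" using A(3) by simp
    then show ?thesis using \<open>independent_set G (insert w A)\<close> A(1) w \<open>J \<subset> I\<close>
      by (intro exI[of _ "insert w A"]) auto
  qed (auto simp: independent_set_def)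
qed

text \<open>Caro-Wei bounds the sum of 1 / (d + 1) over \<open>I\<close> by \<open>a\<close>, and
  Cauchy-Schwarz compares it with the sum of d + 1.\<close>

lemma turan_bound:
  fixes G :: "'v::finite rel" and a :: real
  assumes "simple_graph G" "\<And>A. A \<subseteq> I \<Longrightarrow> independent_set G A \<Longrightarrow> real (card A) \<le> a"
  shows "(real (card I))\<^sup>2 \<le> a * ((\<Sum>v\<in>I. real (card (G `` {v} \<inter> I))) + real (card I))"
proof -
  let ?d = "\<lambda>v. real (card (G `` {v} \<inter> I)) + 1"
  obtain A where "A \<subseteq> I" "independent_set G A" and A: "(\<Sum>v\<in>I. 1 / ?d v) \<le> real (card A)"
    using caro_wei[OF assms(1), of I] by blast
  then have a: "(\<Sum>v\<in>I. 1 / ?d v) \<le> a" using assms(2)[of A] by simp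
  have "(\<Sum>v\<in>I. sqrt (?d v) * sqrt (1 / ?d v))\<^sup>2
      \<le> (\<Sum>v\<in>I. (sqrt (?d v))\<^sup>2) * (\<Sum>v\<in>I. (sqrt (1 / ?d v))\<^sup>2)"
    by (rule Cauchy_Schwarz_ineq_sum)
  moreover have "sqrt (?d v) * sqrt (1 / ?d v) = 1" for v
    by (simp add: real_sqrt_divide)
  ultimately have "(real (card I))\<^sup>2 \<le> (\<Sum>v\<in>I. ?d v) * (\<Sum>v\<in>I. 1 / ?d v)" by simp
  also have "\<dots> \<le> (\<Sum>v\<in>I. ?d v) * a" using a by (intro mult_left_mono sum_nonneg) auto
  finally show ?thesis by (simp add: sum.distrib algebra_simps)
qed

section \<open>Cycles and Hamiltonian paths\<close>

lemma successively_upt: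
  assumes "\<And>i. a \<le> i \<Longrightarrow> Suc i < b \<Longrightarrow> P i (Suc i)"
  shows "successively P [a..<b]"
  unfolding successively_conv_nth using assms by auto

lemma is_cycle_rotate:
  assumes "is_cycle G p"
  shows "is_cycle G (rotate k p)"
proof (induction k)
  case (Suc k)
  then obtain x xs where x: "rotate k p = x # xs" by (cases "rotate k p") (auto simp: is_cycle_def)
  then have "xs \<noteq> []" using Suc by (auto simp: is_cycle_def)
  then show ?case using Suc x
    by (auto simp: is_cycle_def is_path_def successively_append_iff successively_Cons)
qed (use assms in simp)

lemma is_cycleI:
  assumes "length p \<ge> 3" "distinct p" "\<And>k. k < length p \<Longrightarrow> (p ! k, p ! (Suc k mod length p)) \<in> G"
  shows "is_cycle G p"
proof -
  have "p \<noteq> []" using assms(1) by auto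
  have "(p ! k, p ! Suc k) \<in> G" if "Suc k < length p" for k
    using assms(3)[of k] that by simp
  moreover have "(last p, hd p) \<in> G"
    using assms(3)[of "length p - 1"] \<open>p \<noteq> []\<close> by (simp add: last_conv_nth hd_conv_nth)
  ultimately show ?thesis using assms \<open>p \<noteq> []\<close>
    by (auto simp: is_cycle_def is_path_def successively_conv_nth)
qed

text \<open>Rotation by \<open>Suc i\<close> turns the edge that leaves position \<open>i\<close>
  into the implicit closing edge, which opens the cycle at that edge.\<close>

lemma rotate_hd_last:
  assumes "i < length p"
  shows "hd (rotate (Suc i) p) = p ! (Suc i mod length p)" "last (rotate (Suc i) p) = p ! i"
proof -
  have ne: "rotate (Suc i) p \<noteq> []" using assms by (metis length_greater_0_conv length_rotate less_nat_zero_code list.size(3))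
  then show "hd (rotate (Suc i) p) = p ! (Suc i mod length p)"
    using assms hd_rotate_conv_nth[of p "Suc i"] by force
  have "last (rotate (Suc i) p) = p ! ((Suc i + (length p - 1)) mod length p)"
    using ne assms nth_rotate[of "length p - 1" p "Suc i"] by (simp add: last_conv_nth)
  also have "Suc i + (length p - 1) = i + length p" using assms by simp
  finally show "last (rotate (Suc i) p) = p ! i" using assms by simp
qed

lemma complete_hamiltonian:
  fixes G :: "'v::finite rel"
  assumes "CARD('v) \<ge> 3" "\<And>u v. u \<noteq> v \<Longrightarrow> (u, v) \<in> G"
  shows "hamiltonian G"
proof -
  obtain p where p: "set p = (UNIV :: 'v set)" "distinct p"
    using finite_distinct_list[of "UNIV :: 'v set"] by auto
  then have "length p \<ge> 3" using assms(1) distinct_card[of p] by simp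
  moreover have "p ! k \<noteq> p ! (Suc k mod length p)" if "k < length p" for k
    using nth_eq_iff_index_eq[OF p(2), of k "Suc k mod length p"] that \<open>length p \<ge> 3\<close>
    by (cases "p = []") (auto simp: mod_Suc split: if_splits)
  ultimately have "is_cycle G p" using p(2) by (intro is_cycleI assms(2)) auto
  then show ?thesis using p by (auto simp: hamiltonian_def)
qed

text \<open>The Hamiltonian cycle must use the new edge; rotated so that this edge closes it, it is
  a path of \<open>H\<close>, as a cycle of length at least 3 runs through a pair of vertices as
  neighbours only once.\<close>

lemma hamiltonian_insert_edge:
  fixes H :: "'v::finite rel"
  assumes "simple_graph H" "\<not> hamiltonian H" "hamiltonian (insert (u, v) (insert (v, u) H))"
  obtains p where "is_path H p" "set p = UNIV" "{hd p, last p} = {u, v}"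
proof -
  let ?H = "insert (u, v) (insert (v, u) H)"
  obtain p where p: "is_cycle ?H p" "set p = UNIV" using assms(3) by (auto simp: hamiltonian_def)
  then have "\<not> is_cycle H p" using assms(2) by (auto simp: hamiltonian_def)
  then obtain i where i: "i < length p" "(p ! i, p ! (Suc i mod length p)) \<notin> H"
    using is_cycleI[of p H] p(1) by (auto simp: is_cycle_def is_path_def)
  define c where "c = rotate (Suc i) p"
  have c: "is_cycle ?H c" unfolding c_def by (rule is_cycle_rotate[OF p(1)])
  have len: "length c \<ge> 3" and "distinct c" "c \<noteq> []" using c by (auto simp: is_cycle_def is_path_def)
  have notin: "(last c, hd c) \<notin> H" unfolding c_def using rotate_hd_last[OF i(1)] i(2) by simp
  moreover have "(last c, hd c) \<in> ?H" using c by (simp add: is_cycle_def)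
  ultimately have ends: "{hd c, last c} = {u, v}" by auto
  have "(c ! k, c ! Suc k) \<in> H" if k: "Suc k < length c" for k
  proof (rule ccontr)
    assume "(c ! k, c ! Suc k) \<notin> H"
    moreover have "(c ! k, c ! Suc k) \<in> ?H"
      using c k by (auto simp: is_cycle_def is_path_def successively_conv_nth)
    ultimately have "{c ! k, c ! Suc k} = {hd c, last c}" using ends by auto
    then have "{c ! k, c ! Suc k} = {c ! 0, c ! (length c - 1)}"
      using \<open>c \<noteq> []\<close> by (simp add: hd_conv_nth last_conv_nth)
    then have "(!) c ` {k, Suc k} = (!) c ` {0, length c - 1}" by simp
    moreover have "inj_on ((!) c) {..<length c}" using \<open>distinct c\<close> by (simp add: inj_on_nth)
    ultimately have "{k, Suc k} = {0, length c - 1}"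
      using k \<open>c \<noteq> []\<close> inj_on_image_eq_iff[of "(!) c" "{..<length c}" "{k, Suc k}" "{0, length c - 1}"] by auto
    then show False using len by (auto simp: doubleton_eq_iff)
  qed
  then have "is_path H c"
    using \<open>distinct c\<close> \<open>c \<noteq> []\<close> by (auto simp: is_path_def successively_conv_nth)
  moreover have "set c = UNIV" using p(2) by (simp add: c_def)
  ultimately show ?thesis using ends by (rule that)
qed

text \<open>The independent set consists of \<open>w\<close> and the successors of its neighbours on the cycle.\<close>

lemma cycle_missing_vertex:
  fixes H :: "'v::finite rel"
  assumes H: "simple_graph H" "\<not> hamiltonian H" and c: "is_cycle H c" "set c = - {w}"
  obtains A where "independent_set H A" "card A = Suc (vertex_degree H w)"
proof -
  have sy: "(a, b) \<in> H \<Longrightarrow> (b, a) \<in> H" and ir: "(a, a) \<notin> H" for a b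
    using H(1) by (auto simp: simple_graph_def irrefl_def dest: symD)
  let ?N = "length c"
  let ?s = "\<lambda>i. c ! (Suc i mod ?N)"
  have N: "?N \<ge> 3" "distinct c" using c(1) by (auto simp: is_cycle_def is_path_def)
  have no: "\<not> is_cycle H (w # d)" if "set d = set c" for d
    using H(2) that c(2) by (auto simp: hamiltonian_def)
  define J where "J = {i. i < ?N \<and> (w, c ! i) \<in> H}"
  have card_J: "card J = vertex_degree H w"
  proof -
    have "H `` {w} = (\<lambda>i. c ! i) ` J"
    proof (intro equalityI subsetI)
      fix v assume v: "v \<in> H `` {w}"
      then have "v \<in> set c" using c(2) ir by auto
      then show "v \<in> (\<lambda>i. c ! i) ` J" using v by (auto simp: J_def in_set_conv_nth)
    qed (auto simp: J_def)
    moreover have "inj_on (\<lambda>i. c ! i) J"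
      using N by (auto simp: inj_on_def J_def nth_eq_iff_index_eq)
    ultimately show ?thesis by (simp add: vertex_degree_def card_image)
  qed
  \<comment> \<open>Otherwise \<open>w\<close> could be inserted between \<open>c ! i\<close> and
    its successor.\<close>
  have 1: "(w, ?s i) \<notin> H" if "i \<in> J" for i
  proof
    assume "(w, ?s i) \<in> H"
    let ?d = "rotate (Suc i) c"
    have d: "is_cycle H ?d" by (rule is_cycle_rotate[OF c(1)])
    have "is_cycle H (w # ?d)"
      using d \<open>(w, ?s i) \<in> H\<close> that rotate_hd_last[of i c] sy c(2)
      by (auto simp: J_def is_cycle_def is_path_def successively_Cons simp del: rotate_Suc)
    then show False using no[of ?d] by simp
  qed
  \<comment> \<open>Otherwise a Hamiltonian cycle runs from \<open>w\<close> to
    \<open>c ! j\<close>, backwards to \<open>?s i\<close>, across to \<open>?s j\<close>, forwards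
    to \<open>c ! i\<close> and back to \<open>w\<close>.\<close>
  have 2: "(?s i, ?s j) \<notin> H" if "i \<in> J" "j \<in> J" "i \<noteq> j" for i j
  proof
    assume adj: "(?s i, ?s j) \<in> H"
    define d where "d = rotate (Suc i) c"
    have d: "is_cycle H d" unfolding d_def by (rule is_cycle_rotate[OF c(1)])
    have ld: "last d = c ! i" and hd: "hd d = ?s i" and len: "length d = ?N" and sd: "set d = set c"
      using rotate_hd_last[of i c] that by (auto simp: d_def J_def)
    have "c ! j \<in> set d" using that by (simp add: J_def d_def)
    then obtain k where k: "k < ?N" "d ! k = c ! j" unfolding in_set_conv_nth len by blast
    have "d ! k = c ! ((Suc i + k) mod ?N)"
      unfolding d_def using k(1) by (rule nth_rotate)
    moreover have "(Suc i + k) mod ?N < ?N" using N by (intro mod_less_divisor) auto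
    ultimately have kj: "(Suc i + k) mod ?N = j"
      using k(2) that(2) nth_eq_iff_index_eq[OF N(2), of "(Suc i + k) mod ?N" j]
      unfolding J_def by auto
    \<comment> \<open>The last vertex of \<open>d\<close> is \<open>c ! i\<close>, so this only
      restates \<open>i \<noteq> j\<close>; it makes the second piece \<open>bs\<close>
      nonempty.\<close>
    have "k \<noteq> ?N - 1"
    proof
      assume "k = ?N - 1"
      then have "Suc i + k = i + ?N" using N by simp
      then have "(Suc i + k) mod ?N = (i + ?N) mod ?N" by (simp only:)
      then show False using kj that by (simp add: J_def)
    qed
    then have k1: "Suc k < ?N" using k(1) by simp
    have "d ! Suc k = c ! ((Suc i + Suc k) mod ?N)"
      unfolding d_def using k1 by (rule nth_rotate)
    also have "(Suc i + Suc k) mod ?N = Suc j mod ?N"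
      using kj by (metis add_Suc_right mod_Suc_eq)
    finally have dk: "d ! Suc k = ?s j" .
    define as bs where "as = take (Suc k) d" and "bs = drop (Suc k) d"
    have ab: "d = as @ bs" "as \<noteq> []" "bs \<noteq> []" using k1 len by (auto simp: as_def bs_def)
    have "hd bs = ?s j" using dk k1 len by (simp add: bs_def hd_drop_conv_nth)
    moreover have "last as = c ! j"
      using k len by (simp add: as_def take_Suc_conv_app_nth)
    moreover have "hd as = ?s i" "last bs = c ! i" using ab hd ld by auto
    moreover have "successively (\<lambda>x y. (y, x) \<in> H) as" "successively (\<lambda>x y. (x, y) \<in> H) bs"
      using d ab sy by (auto simp: is_cycle_def is_path_def successively_append_iff elim!: successively_mono)
    ultimately have "is_cycle H (w # rev as @ bs)"
      using d ab adj that sy sd c(2)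
      by (auto simp: is_cycle_def is_path_def J_def successively_append_iff successively_Cons
          hd_append hd_rev last_rev)
    moreover have "set (rev as @ bs) = set c" using sd ab by simp
    ultimately show False using no by blast
  qed
  define A where "A = insert w (?s ` J)"
  have "w \<notin> ?s ` J"
  proof
    assume "w \<in> ?s ` J"
    then obtain i where "w = ?s i" by auto
    moreover have "?s i \<in> set c" using N by (intro nth_mem mod_less_divisor) auto
    ultimately show False using c(2) by auto
  qed
  moreover have "inj_on ?s J"
  proof (rule inj_onI)
    fix i j assume ij: "i \<in> J" "j \<in> J" "?s i = ?s j"
    moreover have "Suc k mod ?N < ?N" for k using N by (intro mod_less_divisor) auto
    ultimately have "Suc i mod ?N = Suc j mod ?N" using nth_eq_iff_index_eq[OF N(2)] by blast
    then show "i = j" using ij N by (auto simp: J_def mod_Suc split: if_splits)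
  qed
  moreover have "finite J" by (simp add: J_def)
  ultimately have "card A = Suc (vertex_degree H w)" using card_J by (simp add: A_def card_image)
  moreover have "independent_set H A"
    unfolding independent_set_def A_def using 1 2 ir sy by blast
  ultimately show ?thesis using that by blast
qed

section \<open>The closure lemma\<close>

locale hamiltonian_path =
  fixes H :: "'v::finite rel" and f :: "nat \<Rightarrow> 'v" and n :: nat
  assumes simple: "simple_graph H"
    and n_eq: "n = CARD('v)" and n_ge: "n \<ge> 4"
    and bij: "bij_betw f {..<n} UNIV"
    and step: "Suc i < n \<Longrightarrow> (f i, f (Suc i)) \<in> H"
begin

definition adj :: "nat \<Rightarrow> nat \<Rightarrow> bool" where
  "adj i j \<longleftrightarrow> (f i, f j) \<in> H"

lemma adj_sym: "adj i j \<longleftrightarrow> adj j i"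
  using simple by (auto simp: adj_def simple_graph_def dest: symD)

lemma adj_irrefl [simp]: "\<not> adj i i"
  using simple by (auto simp: adj_def simple_graph_def irrefl_def)

lemma adj_step: "Suc i < n \<Longrightarrow> adj i (Suc i)" "Suc i < n \<Longrightarrow> adj (Suc i) i"
  using step adj_sym by (auto simp: adj_def)

lemma f_inj: "i < n \<Longrightarrow> j < n \<Longrightarrow> f i = f j \<longleftrightarrow> i = j"
  using bij by (auto simp: bij_betw_def inj_on_def)

lemma successively_adj_upt [simp]:
  "b \<le> n \<Longrightarrow> successively adj [a..<b]"
  "b \<le> n \<Longrightarrow> successively (\<lambda>i j. adj j i) [a..<b]"
  by (auto intro!: successively_upt adj_step)

text \<open>Cycles are described by lists of positions, joined from intervals and reversed
  intervals, so that only the edges between the pieces need attention.\<close>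

lemma is_cycle_map_index:
  assumes "distinct ks" "set ks \<subseteq> {..<n}" "length ks \<ge> 3" "successively adj ks" "adj (last ks) (hd ks)"
  shows "is_cycle H (map f ks)"
proof -
  have "ks \<noteq> []" using assms(3) by auto
  moreover have "inj_on f (set ks)" using bij assms(2) by (auto simp: bij_betw_def intro: inj_on_subset)
  ultimately show ?thesis
    using assms by (auto simp: is_cycle_def is_path_def distinct_map successively_map adj_def last_map hd_map)
qed

lemma card_neighbours: "card {k. k < n \<and> adj i k} = vertex_degree H (f i)"
proof -
  have "H `` {f i} = f ` {k. k < n \<and> adj i k}"
    using bij by (force simp: adj_def bij_betw_def image_iff)
  moreover have "inj_on f {k. k < n \<and> adj i k}" using bij by (auto simp: bij_betw_def intro: inj_on_subset)
  ultimately show ?thesis by (simp add: vertex_degree_def card_image)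
qed

end

text \<open>
  The sets \<open>A\<close> and \<open>B\<close> below hold the positions that become an end of a Hamiltonian path when the
  path is rotated around its last, respectively first, vertex. The size of \<open>Q\<close> measures how far the
  degree sum of the two ends is from \<open>n - 1\<close>.
\<close>

locale nonhamiltonian_path = hamiltonian_path +
  assumes nonham: "\<not> hamiltonian H"
begin

lemma no_index_cycle:
  assumes "distinct ks" "set ks = {..<n}" "successively adj ks"
  shows "\<not> adj (last ks) (hd ks)"
proof
  assume "adj (last ks) (hd ks)"
  moreover have "length ks = n" using assms(1,2) distinct_card[of ks] by simp
  ultimately have "is_cycle H (map f ks)" using assms n_ge by (intro is_cycle_map_index) auto
  moreover have "set (map f ks) = UNIV" using assms(2) bij by (simp add: bij_betw_def)
  ultimately show False using nonham by (auto simp: hamiltonian_def)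
qed

text \<open>Otherwise the route \<open>0..i\<close>, then \<open>n - 1\<close> down to
  \<open>i + 1\<close>, closes to a Hamiltonian cycle.\<close>

lemma crossing:
  assumes "adj 0 (Suc i)" "Suc i < n"
  shows "\<not> adj (n - 1) i"
proof
  assume a: "adj (n - 1) i"
  have "\<not> adj (last ([0..<Suc i] @ rev [Suc i..<n])) (hd ([0..<Suc i] @ rev [Suc i..<n]))"
    by (rule no_index_cycle)
      (use assms a in \<open>auto simp: successively_append_iff hd_rev adj_sym simp del: upt_Suc\<close>)
  then show False using assms a by (auto simp: last_rev adj_sym hd_append simp del: upt_Suc)
qed

text \<open>The edge would close the route \<open>0..k\<close>, \<open>l..n - 1\<close>, then
  \<open>l - 1\<close> down to \<open>k + 1\<close>. For \<open>l = Suc k\<close> the third piece is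
  empty and \<open>crossing\<close> already gives the contradiction.\<close>

lemma rotation_1:
  assumes "k < l" "l < n" "adj 0 (Suc k)" "adj (n - 1) (l - 1)"
  shows "\<not> adj k l"
proof
  assume a: "adj k l"
  have "l \<noteq> Suc k" using crossing[of k] assms by auto
  then have kl: "Suc k < l" using assms(1) by simp
  let ?ks = "[0..<Suc k] @ [l..<n] @ rev [Suc k..<l]"
  have "\<not> adj (last ?ks) (hd ?ks)"
    by (rule no_index_cycle)
      (use assms a kl in \<open>auto simp: successively_append_iff hd_rev hd_append simp del: upt_Suc\<close>)
  then show False using assms kl by (auto simp: last_rev adj_sym hd_append simp del: upt_Suc)
qed

text \<open>The edge would close the route \<open>0..l\<close>, \<open>k\<close> down to
  \<open>l + 1\<close>, then \<open>n - 1\<close> down to \<open>k + 1\<close>.\<close>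

lemma rotation_2:
  assumes "l < k" "Suc k < n" "adj (n - 1) (Suc l)" "adj 0 (Suc k)"
  shows "\<not> adj l k"
proof
  assume a: "adj l k"
  let ?ks = "[0..<Suc l] @ rev [Suc l..<Suc k] @ rev [Suc k..<n]"
  have "\<not> adj (last ?ks) (hd ?ks)"
    by (rule no_index_cycle)
      (use assms a adj_sym[of "n - 1"] in \<open>auto simp: successively_append_iff hd_rev hd_append last_rev simp del: upt_Suc\<close>)
  then show False using assms by (auto simp: last_rev adj_sym hd_append simp del: upt_Suc)
qed

text \<open>The edge would close the route \<open>0..l - 1\<close>, \<open>n - 1\<close> down to
  \<open>k\<close>, then \<open>l..k - 1\<close>.\<close>

lemma rotation_3:
  assumes "1 \<le> l" "l < k" "k < n" "adj (n - 1) (l - 1)" "adj 0 (k - 1)"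
  shows "\<not> adj l k"
proof
  assume a: "adj l k"
  let ?ks = "[0..<l] @ rev [k..<n] @ [l..<k]"
  have "\<not> adj (last ?ks) (hd ?ks)"
    by (rule no_index_cycle)
      (use assms a adj_sym[of "n - 1"] adj_sym[of l] in \<open>auto simp: successively_append_iff hd_rev hd_append last_rev simp del: upt_Suc\<close>)
  then show False using assms by (auto simp: last_rev adj_sym hd_append simp del: upt_Suc)
qed

definition A :: "nat set" where "A = {k. Suc k < n \<and> adj 0 (Suc k)}"
definition B :: "nat set" where "B = {k. 1 \<le> k \<and> k < n \<and> adj (n - 1) (k - 1)}"
definition Q :: "nat set" where "Q = {k. Suc k < n \<and> \<not> adj 0 (Suc k) \<and> \<not> adj (n - 1) k}"

lemma finite_sets [simp]: "finite A" "finite B" "finite Q"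
  by (auto simp: A_def B_def Q_def intro: finite_subset[of _ "{..<n}"])

lemma card_A: "card A = vertex_degree H (f 0)"
proof -
  have "{k. k < n \<and> adj 0 k} = Suc ` A"
  proof (intro equalityI subsetI)
    fix k assume k: "k \<in> {k. k < n \<and> adj 0 k}"
    then obtain j where "k = Suc j" by (cases k) auto
    then show "k \<in> Suc ` A" using k by (auto simp: A_def)
  qed (auto simp: A_def)
  then show ?thesis using card_neighbours[of 0] by (simp add: card_image)
qed

lemma B_eq: "B = Suc ` {k. k < n \<and> adj (n - 1) k}"
proof (intro equalityI subsetI)
  fix k assume k: "k \<in> B"
  then obtain j where "k = Suc j" by (cases k) (auto simp: B_def)
  then show "k \<in> Suc ` {k. k < n \<and> adj (n - 1) k}" using k by (auto simp: B_def)
next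
  fix k assume "k \<in> Suc ` {k. k < n \<and> adj (n - 1) k}"
  then obtain j where j: "k = Suc j" "j < n" "adj (n - 1) j" by auto
  then have "j \<noteq> n - 1" by auto
  then show "k \<in> B" using j by (auto simp: B_def)
qed

lemma card_B: "card B = vertex_degree H (f (n - 1))"
  using card_neighbours[of "n - 1"] by (simp add: B_eq card_image)

text \<open>By \<open>crossing\<close>, \<open>A\<close> and the neighbours of the last position are
  disjoint subsets of \<open>{..<n - 1}\<close>, and \<open>Q\<close> is what remains.\<close>

lemma card_Q: "card Q + vertex_degree H (f 0) + vertex_degree H (f (n - 1)) = n - 1"
proof -
  let ?E = "{k. k < n \<and> adj (n - 1) k}"
  have "k \<noteq> n - 1" if "k \<in> ?E" for k using that by auto
  then have E: "k \<in> ?E \<Longrightarrow> k < n - 1" for k by force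
  have "{..<n - 1} = Q \<union> (A \<union> ?E)"
    using E by (auto simp: Q_def A_def less_diff_conv simp del: One_nat_def)
  then have "n - 1 = card (Q \<union> (A \<union> ?E))" by (metis card_lessThan)
  also have "\<dots> = card Q + card (A \<union> ?E)"
    by (rule card_Un_disjoint) (simp, simp, auto simp: Q_def A_def)
  also have "card (A \<union> ?E) = card A + card ?E"
    by (rule card_Un_disjoint) (simp, simp, use crossing in \<open>auto simp: A_def\<close>)
  finally show ?thesis using card_neighbours[of "n - 1"] card_A by simp
qed

lemma card_neither: "card ({..<n} - (A \<union> B)) = card Q + 1 + card (A \<inter> B)"
proof -
  have "A \<union> B \<subseteq> {..<n}" by (auto simp: A_def B_def)
  then have "card ({..<n} - (A \<union> B)) = n - card (A \<union> B)" by (simp add: card_Diff_subset)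
  moreover have "card (A \<union> B) \<le> n" using card_mono[OF _ \<open>A \<union> B \<subseteq> {..<n}\<close>] by simp
  moreover have "card A + card B = card (A \<union> B) + card (A \<inter> B)" by (rule card_Un_Int) auto
  ultimately show ?thesis using card_Q card_A card_B n_ge by simp
qed

text \<open>The exceptional positions: on \<open>P\<close> the chord from \<open>n - 1\<close> that
  \<open>rotation_2\<close> needs is missing, on \<open>M\<close> the chord from \<open>0\<close>
  that \<open>rotation_3\<close> needs. The bounds \<open>k + 3 \<le> n\<close> and
  \<open>2 \<le> k\<close> leave out positions near the ends, where no partner for such an edge
  exists.\<close>

definition P :: "nat set" where "P = {k \<in> B - A. k + 3 \<le> n \<and> \<not> adj (n - 1) (Suc k)}"
definition M :: "nat set" where "M = {k \<in> A - B. 2 \<le> k \<and> \<not> adj 0 (k - 1)}"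

text \<open>A position \<open>k\<close> of \<open>P\<close> is outside \<open>A\<close>. If it is
  not in \<open>Q\<close>, then \<open>n - 1\<close> is adjacent to \<open>k\<close>, so
  \<open>Suc k\<close> is in \<open>B\<close>; it is then in \<open>A\<close> as well, or else in
  \<open>Q\<close>. The count for \<open>M\<close> is the mirror image.\<close>

lemma card_P: "card P \<le> 2 * card Q + card (A \<inter> B)"
proof -
  have "P \<subseteq> Q \<union> (\<lambda>k. k - 1) ` Q \<union> (\<lambda>k. k - 1) ` (A \<inter> B)"
  proof
    fix k assume k: "k \<in> P"
    have "k \<in> Q \<or> Suc k \<in> Q \<or> Suc k \<in> A \<inter> B"
      using k by (auto simp: P_def Q_def A_def B_def)
    then show "k \<in> Q \<union> (\<lambda>k. k - 1) ` Q \<union> (\<lambda>k. k - 1) ` (A \<inter> B)"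
      by (metis UnI1 UnI2 diff_Suc_1 image_eqI)
  qed
  then have "card P \<le> card (Q \<union> (\<lambda>k. k - 1) ` Q \<union> (\<lambda>k. k - 1) ` (A \<inter> B))"
    by (intro card_mono) auto
  also have "\<dots> \<le> card Q + card ((\<lambda>k. k - 1) ` Q) + card ((\<lambda>k. k - 1) ` (A \<inter> B))"
    by (meson add_le_mono1 card_Un_le le_trans)
  also have "\<dots> \<le> card Q + card Q + card (A \<inter> B)"
    by (intro add_mono card_image_le) auto
  finally show ?thesis by simp
qed

lemma card_M: "card M \<le> 2 * card Q + card (A \<inter> B)"
proof -
  have "M \<subseteq> Suc ` Q \<union> (\<lambda>k. Suc (Suc k)) ` Q \<union> Suc ` (A \<inter> B)"
  proof
    fix k assume k: "k \<in> M"
    then obtain j where j: "k = Suc (Suc j)" by (auto simp: M_def dest: le_Suc_ex)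
    have "Suc j \<in> Q \<or> j \<in> Q \<or> Suc j \<in> A \<inter> B"
      using k j by (auto simp: M_def Q_def A_def B_def)
    then show "k \<in> Suc ` Q \<union> (\<lambda>k. Suc (Suc k)) ` Q \<union> Suc ` (A \<inter> B)" using j by auto
  qed
  then have "card M \<le> card (Suc ` Q \<union> (\<lambda>k. Suc (Suc k)) ` Q \<union> Suc ` (A \<inter> B))"
    by (intro card_mono) auto
  also have "\<dots> \<le> card (Suc ` Q) + card ((\<lambda>k. Suc (Suc k)) ` Q) + card (Suc ` (A \<inter> B))"
    by (meson add_le_mono1 card_Un_le le_trans)
  also have "\<dots> \<le> card Q + card Q + card (A \<inter> B)"
    by (intro add_mono card_image_le) auto
  finally show ?thesis by simp
qed

end

context nonhamiltonian_path
begin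

lemma A_B_nonadjacent: "k \<in> A \<Longrightarrow> l \<in> B \<Longrightarrow> k < l \<Longrightarrow> \<not> adj k l"
  by (rule rotation_1) (auto simp: A_def B_def)

lemma B_A_nonadjacent:
  assumes "l \<in> B - A" "l \<notin> P" "k \<in> A" "l < k"
  shows "\<not> adj l k"
proof (cases "l + 3 \<le> n")
  case True
  then show ?thesis using assms by (intro rotation_2) (auto simp: A_def P_def)
qed (use assms in \<open>auto simp: A_def\<close>)

lemma both_A_nonadjacent:
  assumes "l \<in> A \<inter> B" "k \<in> A - B" "k \<notin> M" "l < k"
  shows "\<not> adj l k"
  by (rule rotation_3) (use assms in \<open>auto simp: A_def B_def M_def\<close>)

text \<open>
  Removing the positions in neither \<open>A\<close> nor \<open>B\<close>, together with \<open>P\<close> and \<open>M\<close>, separates \<open>A - B\<close>,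
  \<open>B - A\<close> and the single vertices of \<open>A \<inter> B\<close> from one another. If \<open>A \<inter> B\<close> is empty, \<open>M\<close> can stay.
\<close>

lemma separation:
  assumes "tough t H" "t \<ge> 0"
  shows "t * (real (card (A \<inter> B)) + 2)
    \<le> 1 + 3 * real (card Q) + 2 * real (card (A \<inter> B))
      + (if A \<inter> B = {} then 0 else 2 * real (card Q) + real (card (A \<inter> B)))"
proof -
  define M' where "M' = (if A \<inter> B = {} then {} else M)"
  define K where "K = ({..<n} - (A \<union> B)) \<union> P \<union> M'"
  define S where "S = f ` K"
  define g where "g = inv_into {..<n} f"
  have fg: "f (g v) = v" "g v < n" for v
    using bij f_inv_into_f[of v f "{..<n}"] inv_into_into[of v f "{..<n}"]
    by (auto simp: bij_betw_def g_def)
  have gf: "g (f i) = i" if "i < n" for i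
    using that bij by (auto simp: bij_betw_def g_def)
  \<comment> \<open>The two blocks are labelled by the path ends they contain; a position in both
    sets is labelled by its own vertex.\<close>
  define c where "c = (\<lambda>i. if i \<in> A - B then f 0 else if i \<in> B - A then f (n - 1) else f i)"
  have "M' \<subseteq> A - B" "P \<subseteq> B - A" by (auto simp: M'_def M_def P_def)
  have AB: "A \<subseteq> {..<n}" "B \<subseteq> {..<n}" by (auto simp: A_def B_def)
  \<comment> \<open>The three rotations exclude all edges except those inside one block.\<close>
  have c: "c i = c j" if "i < n" "j < n" "i \<notin> K" "j \<notin> K" "adj i j" "i < j" for i j
  proof -
    have "i \<in> A \<union> B" "j \<in> A \<union> B" "i \<notin> P" "j \<notin> M'" using that by (auto simp: K_def)
    moreover have "\<not> (i \<in> A \<and> j \<in> B)" using A_B_nonadjacent that by blast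
    moreover have "\<not> (i \<in> B - A \<and> j \<in> A)"
      using B_A_nonadjacent that \<open>i \<notin> P\<close> by blast
    moreover have "\<not> (i \<in> A \<inter> B \<and> j \<in> A - B)"
    proof
      assume ij: "i \<in> A \<inter> B \<and> j \<in> A - B"
      then have "M' = M" by (auto simp: M'_def)
      then show False using both_A_nonadjacent[of i j] that \<open>j \<notin> M'\<close> ij by blast
    qed
    ultimately consider "i \<in> A - B" "j \<in> A - B" | "i \<in> B - A" "j \<in> B - A" by blast
    then show ?thesis by cases (simp_all add: c_def)
  qed
  have "c i = c j" if "i < n" "j < n" "i \<notin> K" "j \<notin> K" "adj i j" for i j
    using c[of i j] c[of j i] that adj_sym[of i j] by (metis nat_neq_iff)
  then have lab: "c (g u) = c (g v)" if "u \<notin> S" "v \<notin> S" "(u, v) \<in> H" for u v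
    using that fg unfolding S_def adj_def by (metis imageI)
  have Kn: "K \<subseteq> {..<n}" using AB \<open>M' \<subseteq> A - B\<close> \<open>P \<subseteq> B - A\<close> by (auto simp: K_def)
  have outside: "c i \<in> (c \<circ> g) ` (- S)" if "i < n" "i \<notin> K" for i
  proof -
    have "f i \<notin> S" using that Kn f_inj by (auto simp: S_def)
    then show ?thesis using gf[OF that(1)] by (intro image_eqI[of _ _ "f i"]) auto
  qed
  have first: "0 \<in> A - B" "0 \<notin> K"
    using adj_step(1)[of 0] n_ge by (auto simp: A_def B_def K_def P_def M'_def M_def)
  have "Suc (n - 2) = n - 1" "n - 1 < n" using n_ge by auto
  then have last: "n - 1 \<in> B - A" "n - 1 \<notin> K"
    using adj_step(2)[of "n - 2"] n_ge by (auto simp: A_def B_def K_def P_def M'_def M_def numeral_2_eq_2)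
  have both: "i \<notin> K" if "i \<in> A \<inter> B" for i
    using that \<open>M' \<subseteq> A - B\<close> \<open>P \<subseteq> B - A\<close> by (auto simp: K_def)
  let ?Z = "insert (f 0) (insert (f (n - 1)) (f ` (A \<inter> B)))"
  have "f 0 \<in> (c \<circ> g) ` (- S)" using outside[of 0] first n_ge by (simp add: c_def)
  moreover have "f (n - 1) \<in> (c \<circ> g) ` (- S)" using outside[of "n - 1"] last n_ge by (simp add: c_def)
  moreover have "f i \<in> (c \<circ> g) ` (- S)" if "i \<in> A \<inter> B" for i
    using outside[of i] both that AB by (auto simp: c_def)
  ultimately have "?Z \<subseteq> (c \<circ> g) ` (- S)" by auto
  then have "card ?Z \<le> card ((c \<circ> g) ` (- S))" by (intro card_mono) auto
  moreover have "card ?Z = card (A \<inter> B) + 2"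
  proof -
    have "inj_on f (A \<inter> B)" using AB bij by (auto simp: bij_betw_def intro: inj_on_subset)
    then have "card (f ` (A \<inter> B)) = card (A \<inter> B)" by (rule card_image)
    moreover have "f (n - 1) \<notin> f ` (A \<inter> B)" "f 0 \<notin> insert (f (n - 1)) (f ` (A \<inter> B))"
      using first last f_inj AB n_ge by (auto simp: subset_iff)
    ultimately show ?thesis by simp
  qed
  ultimately have ge: "card (A \<inter> B) + 2 \<le> card ((c \<circ> g) ` (- S))" by simp
  have "t * (real (card (A \<inter> B)) + 2) \<le> t * real (card ((c \<circ> g) ` (- S)))"
    using ge assms(2) by (intro mult_left_mono) linarith+
  also have "\<dots> \<le> real (card S)"
    by (rule tough_labelling[OF assms])
      (use ge lab simple in \<open>auto simp: simple_graph_def\<close>)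
  also have "card S \<le> card ({..<n} - (A \<union> B)) + card P + card M'"
  proof -
    have "card S \<le> card K" unfolding S_def by (rule card_image_le) (use Kn finite_subset in auto)
    also have "\<dots> \<le> card ({..<n} - (A \<union> B)) + card P + card M'"
      unfolding K_def by (meson add_le_mono1 card_Un_le le_trans)
    finally show ?thesis .
  qed
  finally have "t * (real (card (A \<inter> B)) + 2)
    \<le> real (card Q) + 1 + real (card (A \<inter> B)) + real (card P) + real (card M')"
    using card_neither by simp
  moreover have "real (card P) \<le> 2 * real (card Q) + real (card (A \<inter> B))"
    using card_P by linarith
  moreover have "real (card M') \<le> (if A \<inter> B = {} then 0 else 2 * real (card Q) + real (card (A \<inter> B)))"
    using card_M by (simp add: M'_def)
  ultimately show ?thesis by linarith
qed

text \<open>Such a position can be skipped: \<open>0..x - 1\<close>, then \<open>n - 1\<close> down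
  to \<open>x + 1\<close>, closes at \<open>0\<close>.\<close>

lemma both_ends_cycle:
  assumes "x \<in> A \<inter> B"
  shows "\<exists>c. is_cycle H c \<and> set c = - {f x}"
proof -
  let ?ks = "[0..<x] @ rev [Suc x..<n]"
  have x: "1 \<le> x" "Suc x < n" "adj 0 (Suc x)" "adj (n - 1) (x - 1)"
    using assms by (auto simp: A_def B_def)
  have "is_cycle H (map f ?ks)"
    by (rule is_cycle_map_index)
      (use x n_ge in \<open>auto simp: successively_append_iff hd_append hd_rev last_rev adj_sym simp del: upt_Suc\<close>)
  moreover have "set ?ks = {..<n} - {x}" using x by auto
  then have "set (map f ?ks) = f ` ({..<n} - {x})" by (simp only: set_map)
  moreover have "f ` ({..<n} - {x}) = - {f x}"
    using bij x by (auto simp: bij_betw_def inj_on_def)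
  ultimately show ?thesis by metis
qed

end

text \<open>Here \<open>s\<close> is the size of \<open>Q\<close>. If \<open>A \<inter> B\<close> is
  empty, \<open>separation\<close> gives the first alternative. Otherwise \<open>Q\<close> is
  nonempty, and a cycle missing a single vertex yields an independent set of at least 2t + 1
  vertices, which toughness allows only for large n.\<close>

lemma closure_lemma:
  fixes H :: "'v::finite rel"
  assumes t: "t \<ge> 4" "tough t H" and H: "simple_graph H" "\<not> hamiltonian H" and n: "CARD('v) \<ge> 4"
    and uv: "hamiltonian (insert (u, v) (insert (v, u) H))"
  obtains s where "s + vertex_degree H u + vertex_degree H v = CARD('v) - 1"
    "2 * t - 1 \<le> 3 * real s \<or> 1 \<le> s \<and> (2 * t + 1) * (t + 1) \<le> real CARD('v)"
proof -
  obtain p where p: "is_path H p" "set p = UNIV" "{hd p, last p} = {u, v}"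
    using hamiltonian_insert_edge[OF H uv] by blast
  define m where "m = CARD('v)"
  have len: "length p = m" "distinct p" "p \<noteq> []"
    using p distinct_card[of p] by (auto simp: is_path_def m_def)
  interpret nonhamiltonian_path H "\<lambda>i. p ! i" m
  proof
    show "bij_betw (\<lambda>i. p ! i) {..<m} UNIV"
      using bij_betw_nth[OF len(2), of "{..<m}" UNIV] p(2) len by simp
    show "(p ! i, p ! Suc i) \<in> H" if "Suc i < m" for i
      using p(1) that len by (auto simp: is_path_def successively_conv_nth)
  qed (use H n in \<open>auto simp: m_def\<close>)
  have ends: "{p ! 0, p ! (m - 1)} = {u, v}"
    using p(3) len by (simp add: hd_conv_nth last_conv_nth)
  have "card Q + vertex_degree H u + vertex_degree H v = m - 1"
    using card_Q ends by (auto simp: doubleton_eq_iff)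
  moreover have "2 * t - 1 \<le> 3 * real (card Q) \<or> 1 \<le> card Q \<and> (2 * t + 1) * (t + 1) \<le> real m"
  proof (cases "A \<inter> B = {}")
    case True
    then show ?thesis using separation[OF t(2)] t(1) by simp
  next
    case False
    then obtain x where x: "x \<in> A \<inter> B" by blast
    have "card Q \<noteq> 0"
    proof
      assume "card Q = 0"
      \<comment> \<open>With a the size of \<open>A \<inter> B\<close>, this would need 4(a + 2)
        \<le> 1 + 3a.\<close>
      then have "t * (real (card (A \<inter> B)) + 2) \<le> 1 + 3 * real (card (A \<inter> B))"
        using separation[OF t(2)] t(1) False by (simp split: if_splits)
      moreover have "4 * (real (card (A \<inter> B)) + 2) \<le> t * (real (card (A \<inter> B)) + 2)"
        using t(1) by (intro mult_right_mono) auto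
      ultimately show False by simp
    qed
    obtain c where "is_cycle H c" "set c = - {p ! x}" using both_ends_cycle[OF x] by blast
    then obtain I where I: "independent_set H I" "card I = Suc (vertex_degree H (p ! x))"
      using cycle_missing_vertex[OF H] by blast
    have sy: "sym H" using H(1) by (simp add: simple_graph_def)
    have "2 * t \<le> real (vertex_degree H (p ! x))"
    proof (cases "\<exists>z. z \<noteq> p ! x \<and> (p ! x, z) \<notin> H")
      case True
      then obtain z where "p ! x \<noteq> z" "(p ! x, z) \<notin> H" by metis
      then show ?thesis using tough_degree[OF t(2) _ H(1), of "p ! x" z] t(1) by simp
    next
      \<comment> \<open>If \<open>p ! x\<close> were adjacent to all other vertices, the independent
        set \<open>I\<close> would contain every vertex.\<close>
      case False
      then have "H `` {p ! x} = - {p ! x}"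
        using H(1) by (auto simp: simple_graph_def irrefl_def)
      then have "card I = m"
        using I n by (simp add: vertex_degree_def Compl_eq_Diff_UNIV card_Diff_subset m_def)
      then have "(t + 1) * real m \<le> real m"
        using tough_independent_card[OF t(2) _ sy I(1)] t(1) n by (simp add: m_def)
      then show ?thesis using t(1) n by (simp add: m_def)
    qed
    then have I2: "2 * t + 1 \<le> real (card I)" using I by simp
    then have "(t + 1) * real (card I) \<le> real m"
      using tough_independent_card[OF t(2) _ sy I(1)] t(1) by (simp add: m_def)
    moreover have "(2 * t + 1) * (t + 1) \<le> (t + 1) * real (card I)"
      using I2 t(1) by (simp add: mult.commute mult_left_mono)
    ultimately show ?thesis using \<open>card Q \<noteq> 0\<close> by linarith
  qed
  ultimately show ?thesis using that by (simp add: m_def)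
qed

section \<open>Counting edges\<close>

text \<open>For \<open>a \<ge> 0\<close> the quadratic lies below its chord \<open>p * k + q\<close>
  between \<open>x\<close> and \<open>y\<close>, and a linear function is largest at an end.\<close>

lemma quadratic_neg_between:
  fixes a b c k x y :: real
  assumes "a \<ge> 0" "x \<le> k" "k \<le> y"
    and "a * x\<^sup>2 + b * x + c < 0" "a * y\<^sup>2 + b * y + c < 0"
  shows "a * k\<^sup>2 + b * k + c < 0"
proof -
  define p q where "p = a * (x + y) + b" and "q = c - a * x * y"
  have "0 \<le> a * ((k - x) * (y - k))" using assms by simp
  then have "a * k\<^sup>2 + b * k + c \<le> p * k + q"
    by (simp add: p_def q_def algebra_simps power2_eq_square)
  moreover have "p * x + q < 0" "p * y + q < 0"
    using assms(4,5) by (simp_all add: p_def q_def algebra_simps power2_eq_square)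
  moreover have "p * k \<le> p * x \<or> p * k \<le> p * y"
    using assms(2,3) by (cases "p \<ge> 0") (auto intro: mult_left_mono mult_left_mono_neg)
  ultimately show ?thesis by linarith
qed

text \<open>The inequality required by \<open>edge_bound\<close> at
  \<open>k = (n - 1 + T) / 2\<close>, with denominators cleared.\<close>

lemma numeric_upper:
  fixes t n T :: real
  assumes t: "t \<ge> 4" "n > 10 * t - 3"
    and T: "T = (2 * t - 1) / 3 \<or> T = 1 \<and> n \<ge> (2 * t + 1) * (t + 1)"
  shows "8 * t * (2 * n - 5 * t - 1) * (n - t - 1) < (n - 1 + T)\<^sup>2 * n"
proof -
  define r where "r = t - 4"
  have r: "t = 4 + r" "r \<ge> 0" using t by (auto simp: r_def)
  from T show ?thesis
  proof
    assume T: "T = (2 * t - 1) / 3"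
    \<comment> \<open>In terms of the excesses \<open>r\<close> and \<open>s\<close> over the least
      admissible values, the difference becomes a polynomial with positive coefficients.\<close>
    define s where "s = n - (10 * t - 3)"
    have s: "n = 10 * t - 3 + s" "s \<ge> 0" using t by (simp_all add: s_def)
    have "(3 * n + 2 * t - 4)\<^sup>2 * n - 72 * t * (2 * n - 5 * t - 1) * (n - t - 1)
      = 520 * r ^ 3 + 3704 * r ^ 2 + 568 * r ^ 2 * s + 6842 * r + 3436 * r * s + 138 * r * s ^ 2
        + 877 + 5059 * s + 447 * s ^ 2 + 9 * s ^ 3"
      unfolding s(1) r(1) by algebra
    also have "\<dots> > 0" using r(2) s(2) by (intro add_nonneg_pos add_pos_nonneg) auto
    finally have "72 * t * (2 * n - 5 * t - 1) * (n - t - 1) < (3 * n + 2 * t - 4)\<^sup>2 * n" by simp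
    also have "(3 * n + 2 * t - 4)\<^sup>2 = 9 * (n - 1 + T)\<^sup>2"
    proof -
      have "3 * n + 2 * t - 4 = 3 * (n - 1 + T)" using T by simp
      then show ?thesis by (simp only: power_mult_distrib) simp
    qed
    finally have less: "72 * t * (2 * n - 5 * t - 1) * (n - t - 1) < 9 * (n - 1 + T)\<^sup>2 * n" .
    define X Y where "X = t * (2 * n - 5 * t - 1) * (n - t - 1)" and "Y = (n - 1 + T)\<^sup>2 * n"
    have "72 * X < 9 * Y" using less by (simp only: X_def Y_def mult.assoc)
    then have "8 * X < Y" by simp
    then show ?thesis by (simp only: X_def Y_def mult.assoc)
  next
    assume T: "T = 1 \<and> n \<ge> (2 * t + 1) * (t + 1)"
    have tt: "4 * t \<le> t * t" using t by (intro mult_right_mono) auto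
    have n2: "2 * (t * t) + 3 * t + 1 \<le> n" using T by (simp add: algebra_simps)
    \<comment> \<open>The difference to be shown positive is
      \<open>n * (n * n - 16 * (t * n) + 56 * (t * t) + 24 * t)\<close> minus
      \<open>8 * t * (5 * t + 1) * (t + 1)\<close>; completing the square with
      \<open>n - 8 * t\<close> bounds the bracket from below.\<close>
    then have "3 * t \<le> n - 8 * t" using tt t by linarith
    then have "(3 * t)\<^sup>2 \<le> (n - 8 * t)\<^sup>2" using t by (intro power_mono) auto
    then have "t * t + 24 * t \<le> n * n - 16 * (t * n) + 56 * (t * t) + 24 * t"
      by (simp add: power2_eq_square algebra_simps)
    then have "(2 * (t * t) + 3 * t + 1) * (t * t + 24 * t) \<le> n * (n * n - 16 * (t * n) + 56 * (t * t) + 24 * t)"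
      using n2 t by (intro mult_mono) auto
    moreover have "8 * t * (5 * t + 1) * (t + 1) < (2 * (t * t) + 3 * t + 1) * (t * t + 24 * t)"
    proof -
      have "0 < 2 * (t * t * t * t) + 11 * (t * t * t) + 25 * (t * t) + 16 * t"
        using t by (intro add_nonneg_pos) auto
      then show ?thesis by (simp add: algebra_simps)
    qed
    ultimately have "8 * t * (5 * t + 1) * (t + 1) < n * (n * n - 16 * (t * n) + 56 * (t * t) + 24 * t)"
      by (rule less_le_trans[rotated])
    then have "8 * t * (2 * n - 5 * t - 1) * (n - t - 1) < n * n * n" by (simp add: algebra_simps)
    then show ?thesis using T by (simp add: power2_eq_square algebra_simps)
  qed
qed

text \<open>The inequality required by \<open>edge_bound\<close> at the least value
  \<open>k = 2 * t + T\<close>, without the Turan term.\<close>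

lemma numeric_lower:
  fixes t n T :: real
  assumes t: "t \<ge> 4" "n > 10 * t - 3"
    and T: "T = (2 * t - 1) / 3 \<or> T = 1 \<and> n \<ge> (2 * t + 1) * (t + 1)"
  shows "2 * t\<^sup>2 + 4 * t * T + T\<^sup>2 + T + (2 * t + T) < 2 * T * (n - 2 * t)"
  using T
proof
  assume T: "T = (2 * t - 1) / 3"
  have "T > 0" using T t by simp
  have "2 * t\<^sup>2 + 4 * t * T + T\<^sup>2 + T + (2 * t + T) < 2 * T * (8 * t - 3)"
  proof -
    define r where "r = t - 4"
    have r: "t = 4 + r" "r \<ge> 0" using t by (auto simp: r_def)
    have "9 * (2 * T * (8 * t - 3) - (2 * t\<^sup>2 + 4 * t * T + T\<^sup>2 + T + (2 * t + T)))
        = 50 * r\<^sup>2 + 302 * r + 431"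
      unfolding T r(1) by (simp add: algebra_simps power2_eq_square field_simps)
    also have "\<dots> > 0" using r by (intro add_nonneg_pos) auto
    finally show ?thesis by simp
  qed
  also have "\<dots> \<le> 2 * T * (n - 2 * t)"
    using t \<open>T > 0\<close> by (intro mult_left_mono) auto
  finally show ?thesis .
next
  assume T: "T = 1 \<and> n \<ge> (2 * t + 1) * (t + 1)"
  have "4 * t \<le> t * t" using t by (intro mult_right_mono) auto
  then show ?thesis using T t by (simp add: algebra_simps power2_eq_square)
qed

text \<open>
  Here \<open>k\<close> counts the non-neighbours of a vertex and \<open>e\<close> twice the edges among them. The bound is
  monotone in \<open>i\<close>; with the largest possible \<open>i\<close> it is convex in \<open>k\<close> below \<open>(n - 1 + T) / 2\<close> and
  decreasing above.
\<close>

lemma edge_bound: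
  fixes t n T i k e D :: real
  assumes t: "t \<ge> 4" "n > 10 * t - 3"
    and T: "T = (2 * t - 1) / 3 \<or> T = 1 \<and> n \<ge> (2 * t + 1) * (t + 1)"
    and ik: "2 * t \<le> i" "i + T \<le> k" "i + k \<le> n - 1"
    and D: "D \<le> 2 * i * k + (n - k) * (n - k - 1) - e"
    and e: "k\<^sup>2 \<le> (n / (t + 1) - 1) * (e + k)"
  shows "D < n\<^sup>2 - (4 * t + 1) * n + 10 * t\<^sup>2 + 2 * t"
proof -
  \<comment> \<open>With this constant, Turan's bound reads
    \<open>c * k\<^sup>2 \<le> e + k\<close>. At \<open>k = y\<close> the two upper bounds
    \<open>k - T\<close> and \<open>n - 1 - k\<close> on \<open>i\<close> coincide.\<close>
  define c where "c = (t + 1) / (n - t - 1)"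
  define y where "y = (n - 1 + T) / 2"
  let ?N = "n\<^sup>2 - (4 * t + 1) * n + 10 * t\<^sup>2 + 2 * t"
  have d: "n - t - 1 > 0" using t by simp
  have c: "0 \<le> c" "c \<le> 1" using t d by (auto simp: c_def field_simps)
  have T0: "T > 0" using T t by auto
  have k0: "k > 0" using ik T0 t by simp
  have e: "c * k\<^sup>2 \<le> e + k"
  proof -
    have "n / (t + 1) - 1 = (n - t - 1) / (t + 1)" using t by (simp add: field_simps)
    then have "(t + 1) * k\<^sup>2 \<le> (n - t - 1) * (e + k)" using e t by (simp add: field_simps)
    then show ?thesis using d by (simp add: c_def field_simps)
  qed
  have top: "n\<^sup>2 - n - (1 + c) * y\<^sup>2 < ?N"
  proof -
    have c1: "1 + c = n / (n - t - 1)" using d by (simp add: c_def field_simps)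
    have "8 * t * (2 * n - 5 * t - 1) < (n - 1 + T)\<^sup>2 * n / (n - t - 1)"
      using numeric_upper[OF t T] d by (simp add: pos_less_divide_eq)
    also have "(n - 1 + T)\<^sup>2 = 4 * y\<^sup>2" by (simp add: y_def power_divide)
    also have "4 * y\<^sup>2 * n / (n - t - 1) = 4 * ((1 + c) * y\<^sup>2)" by (simp add: c1)
    finally show ?thesis by (simp add: algebra_simps power2_eq_square)
  qed
  show ?thesis
  proof (cases "k \<le> y")
    case False
    have "2 * i * k \<le> 2 * (n - 1 - k) * k" using ik k0 by (intro mult_right_mono) auto
    then have "D \<le> n\<^sup>2 - n - k\<^sup>2 - (e + k)"
      using D by (simp add: algebra_simps power2_eq_square)
    also have "\<dots> \<le> n\<^sup>2 - n - (1 + c) * k\<^sup>2" using e by (simp add: algebra_simps)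
    also have "\<dots> \<le> n\<^sup>2 - n - (1 + c) * y\<^sup>2"
    proof -
      have "0 \<le> y" using T0 t by (simp add: y_def)
      then have "y\<^sup>2 \<le> k\<^sup>2" using False by (intro power_mono) auto
      then show ?thesis using c by (simp add: mult_left_mono)
    qed
    finally show ?thesis using top by simp
  next
    case True
    define b where "b = - 2 * T - 2 * n + 2"
    define g where "g = n\<^sup>2 - n - ?N"
    have "2 * i * k \<le> 2 * (k - T) * k" using ik k0 by (intro mult_right_mono) auto
    then have "D - ?N \<le> (3 - c) * k\<^sup>2 + b * k + g"
      using D e by (simp add: b_def g_def algebra_simps power2_eq_square)
    also have "\<dots> < 0"
    proof (rule quadratic_neg_between)
      show "2 * t + T \<le> k" using ik by simp
      have "2 * t\<^sup>2 + 4 * t * T + T\<^sup>2 + T + (2 * t + T) - 2 * T * (n - 2 * t) < 0"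
        using numeric_lower[OF t T] by simp
      moreover have "0 \<le> c * (2 * t + T)\<^sup>2" using c by simp
      ultimately show "(3 - c) * (2 * t + T)\<^sup>2 + b * (2 * t + T) + g < 0"
        by (simp add: b_def g_def algebra_simps power2_eq_square)
      have "b = 2 - 2 * T - 2 * n" "2 * y = n - 1 + T" by (auto simp: b_def y_def)
      then have "b = - 4 * y" by simp
      then have "(3 - c) * y\<^sup>2 + b * y + g = n\<^sup>2 - n - (1 + c) * y\<^sup>2 - ?N"
        by (simp add: g_def algebra_simps power2_eq_square)
      then show "(3 - c) * y\<^sup>2 + b * y + g < 0" using top by simp
    qed (use c True in auto)
    finally show ?thesis by simp
  qed
qed

text \<open>The edges between \<open>I\<close> and its complement are counted from both sides, so
  the degrees in \<open>I\<close> enter twice, less the pairs inside \<open>I\<close>; the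
  complement itself contributes at most as much as a complete graph.\<close>

lemma card_le_low_degree_set:
  fixes H :: "'v::finite rel"
  assumes H: "simple_graph H" and i: "\<And>w. w \<in> I \<Longrightarrow> vertex_degree H w \<le> i"
  shows "real (card H) \<le> 2 * real i * real (card I)
    + (real CARD('v) - real (card I)) * (real CARD('v) - real (card I) - 1)
    - (\<Sum>w\<in>I. real (card (H `` {w} \<inter> I)))"
proof -
  let ?k = "real (card I)" and ?n = "real CARD('v)"
  let ?e = "\<lambda>w X. real (card (H `` {w} \<inter> X))"
  have split: "real (vertex_degree H w) = ?e w I + ?e w (- I)" for w
  proof -
    have "(H `` {w} \<inter> I) \<union> (H `` {w} \<inter> - I) = H `` {w}" by auto
    moreover have "card ((H `` {w} \<inter> I) \<union> (H `` {w} \<inter> - I)) = card (H `` {w} \<inter> I) + card (H `` {w} \<inter> - I)"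
      by (rule card_Un_disjoint) auto
    ultimately show ?thesis by (simp add: vertex_degree_def)
  qed
  have e_sum: "?e w X = (\<Sum>x\<in>X. if (w, x) \<in> H then 1 else 0)" for w X
  proof -
    have "H `` {w} \<inter> X = {x \<in> X. (w, x) \<in> H}" by auto
    then show ?thesis by (simp add: sum.If_cases Int_def)
  qed
  have swap: "(\<Sum>w\<in>- I. ?e w I) = (\<Sum>w\<in>I. ?e w (- I))"
    unfolding e_sum using H
    by (subst sum.swap) (auto intro!: sum.cong simp: simple_graph_def dest: symD)
  have cI: "real (card (- I)) = ?n - ?k"
    by (simp add: Compl_eq_Diff_UNIV card_Diff_subset card_mono of_nat_diff)
  have "?e w (- I) \<le> ?n - ?k - 1" if "w \<in> - I" for w
  proof -
    have "H `` {w} \<inter> - I \<subseteq> - I - {w}" using H by (auto simp: simple_graph_def irrefl_def)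
    then have "card (H `` {w} \<inter> - I) \<le> card (- I - {w})" by (intro card_mono) auto
    moreover have "card (- I - {w}) = card (- I) - 1" "card (- I) > 0"
      using that by (auto simp: card_gt_0_iff)
    ultimately have "?e w (- I) \<le> real (card (- I)) - 1" by simp
    then show ?thesis using cI by simp
  qed
  then have "(\<Sum>w\<in>- I. ?e w (- I)) \<le> (\<Sum>w\<in>- I. ?n - ?k - 1)" by (intro sum_mono)
  then have 1: "(\<Sum>w\<in>- I. ?e w (- I)) \<le> (?n - ?k) * (?n - ?k - 1)" by (simp add: cI)
  have "(\<Sum>w\<in>I. real (vertex_degree H w)) \<le> (\<Sum>w\<in>I. real i)" using i by (intro sum_mono) simp
  then have 2: "(\<Sum>w\<in>I. real (vertex_degree H w)) \<le> real i * ?k" by (simp add: mult.commute)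
  have "real (card H) = (\<Sum>w\<in>UNIV. real (vertex_degree H w))"
    by (simp flip: sum_vertex_degree)
  also have "\<dots> = (\<Sum>w\<in>I. real (vertex_degree H w)) + (\<Sum>w\<in>- I. real (vertex_degree H w))"
    using sum.subset_diff[of I UNIV "\<lambda>w. real (vertex_degree H w)"] by (simp add: Compl_eq_Diff_UNIV)
  also have "(\<Sum>w\<in>- I. real (vertex_degree H w)) = (\<Sum>w\<in>I. ?e w (- I)) + (\<Sum>w\<in>- I. ?e w (- I))"
    by (simp add: split sum.distrib swap)
  also have "(\<Sum>w\<in>I. ?e w (- I)) = (\<Sum>w\<in>I. real (vertex_degree H w)) - (\<Sum>w\<in>I. ?e w I)"
    by (simp add: split sum.distrib)
  finally show ?thesis using 1 2 by linarith
qed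

section \<open>The edge-maximal counterexample\<close>

theorem tough_hamiltonian:
  fixes G :: "'v::finite rel" and t :: real
  assumes t: "t \<ge> 4" and G: "simple_graph G" "tough t G" and n: "n = CARD('v)" "real n > 10 * t - 3"
    and card: "real (card G) \<ge> (real n)\<^sup>2 - (4 * t + 1) * real n + 10 * t\<^sup>2 + 2 * t"
  shows "hamiltonian G"
proof (rule ccontr)
  assume "\<not> hamiltonian G"
  let ?F = "{H. G \<subseteq> H \<and> simple_graph H \<and> \<not> hamiltonian H}"
  have "G \<in> ?F" using G \<open>\<not> hamiltonian G\<close> by simp
  then obtain H where H: "H \<in> ?F" and max: "\<And>K. K \<in> ?F \<Longrightarrow> H \<subseteq> K \<Longrightarrow> H = K"
    using finite_has_maximal[of ?F] by auto
  have GH: "G \<subseteq> H" and simp: "simple_graph H" and nonham: "\<not> hamiltonian H" using H by auto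
  have sy: "sym H" "\<And>a b. (a, b) \<in> H \<Longrightarrow> (b, a) \<in> H" "\<And>a. (a, a) \<notin> H"
    using simp by (auto simp: simple_graph_def irrefl_def dest: symD)
  have tough: "tough t H"
    using tough_mono[OF G(2) _ _ sy(1) GH] t G(1) by (simp add: simple_graph_def)
  have n4: "CARD('v) \<ge> 4" using n t by linarith
  let ?d = "vertex_degree H"
  let ?non = "\<lambda>p. fst p \<noteq> snd p \<and> p \<notin> H"
  have "\<exists>p. ?non p"
    using complete_hamiltonian[of H] nonham n4 by force
  moreover have "?d (fst p) + ?d (snd p) < Suc (2 * CARD('v))" for p
  proof -
    have "?d w \<le> CARD('v)" for w by (simp add: vertex_degree_def card_mono)
    then have "?d (fst p) \<le> CARD('v)" "?d (snd p) \<le> CARD('v)" by blast+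
    then show ?thesis by simp
  qed
  ultimately obtain p where p: "?non p" "\<And>q. ?non q \<Longrightarrow> ?d (fst q) + ?d (snd q) \<le> ?d (fst p) + ?d (snd p)"
    using ex_has_greatest_nat[of ?non _ "\<lambda>p. ?d (fst p) + ?d (snd p)" "Suc (2 * CARD('v))"]
    by (metis less_imp_le)
  \<comment> \<open>The pair is ordered so that \<open>?d u \<le> ?d v\<close>: the set
    \<open>I\<close> is taken as the non-neighbours of \<open>v\<close>, and maximality bounds their
    degrees by \<open>?d u\<close>.\<close>
  obtain u v where uv: "u \<noteq> v" "(u, v) \<notin> H" "?d u \<le> ?d v"
    and uv_max: "\<And>a b. a \<noteq> b \<Longrightarrow> (a, b) \<notin> H \<Longrightarrow> ?d a + ?d b \<le> ?d u + ?d v"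
  proof (cases "?d (fst p) \<le> ?d (snd p)")
    case True
    then show ?thesis using p that[of "fst p" "snd p"] by force
  next
    case False
    then show ?thesis using p that[of "snd p" "fst p"] sy(2) by force
  qed
  have "hamiltonian (insert (u, v) (insert (v, u) H))"
  proof (rule ccontr)
    assume "\<not> ?thesis"
    then have "insert (u, v) (insert (v, u) H) \<in> ?F"
      using GH simp uv(1) by (auto simp: simple_graph_def sym_def irrefl_def)
    then have "H = insert (u, v) (insert (v, u) H)" by (rule max) auto
    then show False using uv(2) by blast
  qed
  then obtain s where s: "s + ?d u + ?d v = CARD('v) - 1"
    "2 * t - 1 \<le> 3 * real s \<or> 1 \<le> s \<and> (2 * t + 1) * (t + 1) \<le> real CARD('v)"
    using closure_lemma[OF t tough simp nonham n4] by blast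
  define I where "I = - insert v (H `` {v})"
  define k where "k = card I"
  have k: "k + ?d v + 1 = n"
  proof -
    have "card (insert v (H `` {v})) = Suc (?d v)" using sy(3) by (simp add: vertex_degree_def)
    moreover have "card (insert v (H `` {v})) \<le> CARD('v)" by (rule card_mono) auto
    ultimately show ?thesis by (simp add: k_def I_def Compl_eq_Diff_UNIV card_Diff_subset n)
  qed
  have deg_I: "?d w \<le> ?d u" if "w \<in> I" for w
    using uv_max[of v w] that by (auto simp: I_def)
  define e where "e = (\<Sum>w\<in>I. real (card (H `` {w} \<inter> I)))"
  have nt: "real n / (t + 1) \<ge> 1" using n(2) t by (simp add: field_simps)
  \<comment> \<open>No vertex of \<open>I\<close> is adjacent to \<open>v\<close>, so
    \<open>A\<close> stays independent with \<open>v\<close> added; this saves the 1.\<close>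
  have "real (card A) \<le> real n / (t + 1) - 1" if A: "A \<subseteq> I" "independent_set H A" for A
  proof (cases "A = {}")
    case False
    have "v \<notin> A" using A by (auto simp: I_def)
    have ind: "independent_set H (insert v A)"
      using A sy by (auto simp: independent_set_def I_def)
    have "card (insert v A) = Suc (card A)" using \<open>v \<notin> A\<close> by simp
    moreover have "card A \<ge> 1" using False by (simp add: Suc_le_eq card_gt_0_iff)
    ultimately have "(t + 1) * real (Suc (card A)) \<le> real n"
      using tough_independent_card[OF tough _ sy(1) ind] t n(1) by simp
    then show ?thesis using t by (simp add: field_simps)
  qed (use nt in simp)
  then have turan: "(real k)\<^sup>2 \<le> (real n / (t + 1) - 1) * (e + real k)"
    unfolding k_def e_def by (rule turan_bound[OF simp])
  \<comment> \<open>Either alternative of \<open>closure_lemma\<close> makes \<open>T\<close> a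
    lower bound for \<open>s\<close>, and \<open>k\<close> equals \<open>?d u + s\<close>.\<close>
  define T where "T = (if 2 * t - 1 \<le> 3 * real s then (2 * t - 1) / 3 else 1)"
  have "real (card H) < (real n)\<^sup>2 - (4 * t + 1) * real n + 10 * t\<^sup>2 + 2 * t"
  proof (rule edge_bound[OF t n(2) _ _ _ _ _ turan])
    show "T = (2 * t - 1) / 3 \<or> T = 1 \<and> (2 * t + 1) * (t + 1) \<le> real n"
      using s(2) n by (auto simp: T_def)
    show "2 * t \<le> real (?d u)" using tough_degree[OF tough _ simp uv(1,2)] t by simp
    have "k = ?d u + s" using s(1) k n(1) by simp
    moreover have "T \<le> real s" using s(2) by (auto simp: T_def)
    ultimately show "real (?d u) + T \<le> real k" by simp
    show "real (?d u) + real k \<le> real n - 1" using k uv(3) by linarith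
    show "real (card H) \<le> 2 * real (?d u) * real k + (real n - real k) * (real n - real k - 1) - e"
      unfolding k_def e_def n(1) by (rule card_le_low_degree_set[OF simp deg_I])
  qed
  moreover have "card G \<le> card H" using GH by (intro card_mono) auto
  ultimately show False using card by simp
qed

section \<open>Pancyclicity\<close>

lemma (in hamiltonian_path) bondy:
  assumes closed: "adj 0 (n - 1)" and deg: "vertex_degree H (f 0) + vertex_degree H (f (n - 1)) > n"
    and l: "3 \<le> l" "l \<le> n"
  shows "\<exists>p. is_cycle H p \<and> length p = l"
proof -
  define g where "g = n + 1 - l"
  have g: "1 \<le> g" "g \<le> n - 2" "l = n + 1 - g" using l by (auto simp: g_def)
  define F where "F = {j. 1 \<le> j \<and> j < n - 1 \<and> adj 0 j}"
  define E where "E = {j. j < n - 2 \<and> adj (n - 1) j}"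
  \<comment> \<open>A shift down by \<open>g\<close>, taken cyclically modulo \<open>n - 2\<close>,
    which keeps it injective on \<open>F\<close>.\<close>
  define \<phi> where "\<phi> j = (if g \<le> j then j - g else j + (n - 2 - g))" for j
  have fin: "finite F" "finite E" by (auto simp: F_def E_def)
  have cF: "vertex_degree H (f 0) = Suc (card F)"
  proof -
    have "{k. k < n \<and> adj 0 k} = insert (n - 1) F"
    proof (intro equalityI subsetI)
      fix k assume k: "k \<in> {k. k < n \<and> adj 0 k}"
      then have "k \<noteq> 0" by (metis adj_irrefl mem_Collect_eq)
      then show "k \<in> insert (n - 1) F" using k by (auto simp: F_def)
    qed (use closed n_ge in \<open>auto simp: F_def\<close>)
    moreover have "n - 1 \<notin> F" by (simp add: F_def)
    ultimately show ?thesis using card_neighbours[of 0] fin by simp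
  qed
  have cE: "vertex_degree H (f (n - 1)) = Suc (card E)"
  proof -
    have n2: "Suc (n - 2) = n - 1" using n_ge by simp
    have "{k. k < n \<and> adj (n - 1) k} = insert (n - 2) E"
    proof (intro equalityI subsetI)
      fix k assume k: "k \<in> {k. k < n \<and> adj (n - 1) k}"
      then have "k \<noteq> n - 1" by (metis adj_irrefl mem_Collect_eq)
      then show "k \<in> insert (n - 2) E" using k n2 by (auto simp: E_def)
    qed (use adj_step(2)[of "n - 2"] n_ge n2 in \<open>auto simp: E_def\<close>)
    moreover have "n - 2 \<notin> E" by (simp add: E_def)
    ultimately show ?thesis using card_neighbours[of "n - 1"] fin by simp
  qed
  have "\<phi> ` F \<inter> E \<noteq> {}"
  proof
    assume disj: "\<phi> ` F \<inter> E = {}"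
    have "inj_on \<phi> F" using g by (auto simp: inj_on_def \<phi>_def F_def split: if_splits)
    moreover have "\<phi> ` F \<subseteq> {..<n - 2}" "E \<subseteq> {..<n - 2}"
      using g by (auto simp: \<phi>_def F_def E_def)
    then have "card (\<phi> ` F \<union> E) \<le> card {..<n - 2}" by (intro card_mono) auto
    ultimately have "card F + card E \<le> n - 2"
      using disj fin by (simp add: card_Un_disjoint card_image)
    then show False using cF cE deg n_ge by linarith
  qed
  then obtain j where j: "j \<in> F" "\<phi> j \<in> E" by auto
  define a where "a = \<phi> j"
  have a: "a < n - 2" "adj (n - 1) a" and j': "1 \<le> j" "j < n - 1" "adj 0 j"
    using j by (auto simp: a_def E_def F_def)
  show ?thesis
  proof (cases "g \<le> j")
    case True
    then have aj: "a < j" "a + g = j" using g by (auto simp: a_def \<phi>_def)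
    \<comment> \<open>The length is \<open>(a + 1) + (n - j) = n + 1 - g\<close>.\<close>
    let ?ks = "[0..<Suc a] @ rev [j..<n]"
    have len: "length ?ks = l" using aj j' g by simp
    moreover have "is_cycle H (map f ?ks)"
      by (rule is_cycle_map_index)
        (use a aj j' l len n_ge in \<open>auto simp: successively_append_iff hd_append hd_rev last_rev adj_sym simp del: upt_Suc\<close>)
    ultimately show ?thesis by (metis length_map)
  next
    case False
    then have aj: "j \<le> a" "a = j + l - 3" using g l by (auto simp: a_def \<phi>_def)
    \<comment> \<open>The wrapped-around case uses the closing edge of the Hamiltonian cycle; the
      length is \<open>a - j + 3\<close>.\<close>
    let ?ks = "0 # [j..<Suc a] @ [n - 1]"
    have len: "length ?ks = l" using aj j' g l by simp
    moreover have "is_cycle H (map f ?ks)"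
      by (rule is_cycle_map_index)
        (use a aj j' l len n_ge closed in \<open>auto simp: successively_append_iff successively_Cons hd_append adj_sym simp del: upt_Suc\<close>)
    ultimately show ?thesis by (metis length_map)
  qed
qed

text \<open>Summed around the cycle, the degree sums of consecutive vertices total
  \<open>2 * card G\<close>, so one of them exceeds n; the cycle is opened at that edge.\<close>

theorem hamiltonian_imp_pancyclic:
  fixes G :: "'v::finite rel"
  assumes G: "simple_graph G" "hamiltonian G" and n: "CARD('v) \<ge> 4"
    and card: "2 * card G > CARD('v) * CARD('v)"
  shows "pancyclic G"
proof -
  define n where "n = CARD('v)"
  obtain p where p: "is_cycle G p" "set p = UNIV" using G(2) by (auto simp: hamiltonian_def)
  have len: "length p = n" "distinct p"
    using p distinct_card[of p] by (auto simp: is_cycle_def is_path_def n_def)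
  have n0: "n \<ge> 4" using n by (simp add: n_def)
  let ?d = "\<lambda>i. vertex_degree G (p ! i)"
  have sum_d: "(\<Sum>i<n. ?d i) = card G"
  proof -
    have "bij_betw (\<lambda>i. p ! i) {..<n} UNIV" using bij_betw_nth[OF len(2), of "{..<n}" UNIV] p(2) len by simp
    then show ?thesis using sum_vertex_degree[of G] by (simp add: sum.reindex_bij_betw)
  qed
  have sum_shift: "(\<Sum>i<n. ?d (Suc i mod n)) = card G"
  proof -
    have "inj_on (\<lambda>i. Suc i mod n) {..<n}" by (auto simp: inj_on_def mod_Suc split: if_splits)
    moreover have "(\<lambda>i. Suc i mod n) ` {..<n} \<subseteq> {..<n}" using n0 by auto
    ultimately have "bij_betw (\<lambda>i. Suc i mod n) {..<n} {..<n}"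
      by (metis bij_betw_def endo_inj_surj finite_lessThan)
    then have "(\<Sum>i<n. ?d (Suc i mod n)) = (\<Sum>i<n. ?d i)" by (rule sum.reindex_bij_betw)
    then show ?thesis using sum_d by simp
  qed
  have "\<exists>i<n. ?d i + ?d (Suc i mod n) > n"
  proof (rule ccontr)
    assume "\<not> ?thesis"
    then have "(\<Sum>i<n. ?d i + ?d (Suc i mod n)) \<le> (\<Sum>i<n. n)" by (intro sum_mono) (meson lessThan_iff not_less)
    then show False using sum_d sum_shift card by (simp add: sum.distrib n_def)
  qed
  then obtain i where i: "i < n" "?d i + ?d (Suc i mod n) > n" by blast
  define c where "c = rotate (Suc i) p"
  have c: "is_cycle G c" unfolding c_def by (rule is_cycle_rotate[OF p(1)])
  have clen: "length c = n" "distinct c" "set c = UNIV" using len p(2) by (auto simp: c_def)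
  then have "c \<noteq> []" using n0 by auto
  then have hl: "hd c = c ! 0" "last c = c ! (n - 1)" using clen by (auto simp: hd_conv_nth last_conv_nth)
  interpret hamiltonian_path G "\<lambda>i. c ! i" n
  proof
    show "bij_betw (\<lambda>i. c ! i) {..<n} UNIV"
      using bij_betw_nth[OF clen(2), of "{..<n}" UNIV] clen by simp
    show "(c ! i, c ! Suc i) \<in> G" if "Suc i < n" for i
      using c that clen by (auto simp: is_cycle_def is_path_def successively_conv_nth)
  qed (use G n0 in \<open>auto simp: n_def\<close>)
  have "adj (n - 1) 0" using c hl by (simp add: adj_def is_cycle_def)
  moreover have "hd c = p ! (Suc i mod n)" "last c = p ! i"
    using rotate_hd_last[of i p] i(1) len unfolding c_def by auto
  ultimately show ?thesis
    using bondy i(2) hl adj_sym unfolding pancyclic_def n_def[symmetric] by (simp add: add.commute)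
qed

text \<open>Completing the square in \<open>n\<close> leaves the constant 4t^2 - 4t - 1, which is
  positive for these \<open>t\<close>.\<close>

lemma edge_count_gt_half:
  fixes n t :: real
  assumes "t \<ge> 4"
  shows "n\<^sup>2 < 2 * (n\<^sup>2 - (4 * t + 1) * n + 10 * t\<^sup>2 + 2 * t)"
proof -
  have tt: "4 * t \<le> t * t" using assms by (intro mult_right_mono) auto
  have "2 * (n\<^sup>2 - (4 * t + 1) * n + 10 * t\<^sup>2 + 2 * t) - n\<^sup>2
      = (n - (4 * t + 1))\<^sup>2 + (4 * (t * t) - 4 * t - 1)"
    by (simp add: power2_eq_square algebra_simps)
  also have "\<dots> > 0" using tt assms by (intro add_nonneg_pos) (simp, linarith)
  finally show ?thesis by simp
qed

theorem theorem1p2: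
  fixes t :: real and n m :: nat and G :: "'v::finite rel"
  assumes "t \<ge> 4"
    and "simple_graph G" and "connected_graph G" and "tough t G"
    and "n = CARD('v)" and "m = card (edges G)"
    and "real n > 10 * t - 3"
    and "largest_eigenvalue (adjacency_matrix G)
           \<ge> sqrt ((real n)\<^sup>2 - (4 * t + 2) * real n + 10 * t\<^sup>2 + 2 * t + 1)
       \<or> largest_eigenvalue (signless_laplacian G)
           \<ge> ((real n)\<^sup>2 - (4 * t + 1) * real n + 10 * t\<^sup>2 + 2 * t) / (real n - 1) + real n - 2
       \<or> largest_eigenvalue (distance_matrix G)
           \<le> real n + 4 * t - 1 - (10 * t\<^sup>2 + 2 * t) / real n
       \<or> largest_eigenvalue (distance_signless_laplacian G)
           \<le> 2 * real n + 8 * t - 2 - (20 * t\<^sup>2 + 4 * t) / real n"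
  shows "hamiltonian G \<and> (pancyclic G \<or> bipartite G)"
proof -
  have n4: "n \<ge> 4" using assms(1,7) by linarith
  have card: "real (card G) \<ge> (real n)\<^sup>2 - (4 * t + 1) * real n + 10 * t\<^sup>2 + 2 * t"
    by (rule spectral_condition_card[OF assms(2,3,5) _ assms(8)]) (use n4 in simp)
  then have "(real n)\<^sup>2 < 2 * real (card G)"
    using less_le_trans[OF edge_count_gt_half[OF assms(1)] mult_left_mono[OF card, of 2]] by simp
  then have "real (n * n) < real (2 * card G)" by (simp add: power2_eq_square)
  then have "CARD('v) * CARD('v) < 2 * card G" using assms(5) by (simp only: of_nat_less_iff)
  moreover have ham: "hamiltonian G" by (rule tough_hamiltonian[OF assms(1,2,4,5,7) card])
  ultimately have "pancyclic G" using hamiltonian_imp_pancyclic[OF assms(2)] n4 assms(5) by simp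
  then show ?thesis using ham by simp
qed

end
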